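(* Let $n\ge 1$, $\gamma\in(0,1)$, $T>0$, $\tau>0$, $s>0$, $p>0$, $E>0$, $\delta>0$. Let $u$ be the solution of the final value problem $\partial_t^\gamma u=\Delta u$ on $\mathbb{R}^n\times(0,T)$, $u(\cdot,T)=g$, and assume $u(\cdot,0)\in H^p(\mathbb{R}^n)$ with $\|u(\cdot,0)\|_{H^p}\le E$. Let $g^\delta\in L^2(\mathbb{R}^n)$ satisfy $\|g-g^\delta\|_{L^2}\le\delta$ and, for $\alpha>0$, let $u_\alpha^\delta$ be the regularized solution associated with $g^\delta$ and $\alpha$. Then, for the a-priori choice $\alpha(\delta)=(\delta/E)^{\frac{1}{p+2}}$, for all $l\in[0,p]$ such that $p-l\le s$, $$\big\|u(\cdot,0)-u_{\alpha(\delta)}^\delta(\cdot,0)\big\|_{H^l}\le C\,E^{\frac{2+l}{p+2}}\,\delta^{\frac{p-l}{p+2}},$$ where $C$ is a constant independent of $\delta$ and $E$.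
   Context: The Fourier transform is $\widehat f(\xi)=(2\pi)^{-n/2}\int_{\mathbb{R}^n}f(x)e^{-ix\cdot\xi}\,dx$, and $\|f\|_{H^p}=\|(1+|\xi|^2)^{p/2}\widehat f\|_{L^2}$. $\partial_t^\gamma$ is the Caputo derivative $\partial_t^\gamma u(t)=\frac{1}{\Gamma(1-\gamma)}\int_0^t\frac{u'(r)}{(t-r)^\gamma}\,dr$. $E_{\gamma,1}(z)=\sum_{k\ge0}\frac{z^k}{\Gamma(\gamma k+1)}$ is the Mittag-Leffler function. A solution of $\partial_t^\gamma u=\Delta u$ is understood through its frequency representation $\widehat u(\xi,t)=\widehat u(\xi,0)\,E_{\gamma,1}(-|\xi|^2t^\gamma)$, $t\in[0,T]$ (transform in $x$); thus $\widehat g(\xi)=\widehat u(\xi,0)E_{\gamma,1}(-|\xi|^2T^\gamma)$ for $g=u(\cdot,T)$. The regularized solution $u_\alpha^\delta$ is defined by $$\widehat{u_\alpha^\delta}(\xi,t)=\frac{E_{\gamma,1}(-|\xi|^2t^\gamma)}{E_{\gamma,1}(-|\xi|^2T^\gamma)}\,e^{-\tau(\alpha|\xi|)^s}\,\widehat{g^\delta}(\xi),\qquad t\in[0,T].$$ Here $E>0$ (a bound on the Sobolev norm) is not to be confused with the function $E_{\gamma,1}$.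
   Formalization: The noise-to-bound ratio is assumed bounded, δ ≤ K·E for an arbitrary fixed K>0, and C may depend on K; without this no C independent of δ and E exists (take u=0, E=1, δ→∞). *)

theory Defs
  imports "HOL-Analysis.Analysis"
begin

text \<open>
  Elements of \<open>L\<^sup>2\<close> are represented by Borel functions; every class of Lebesgue measurable functions
  modulo equality almost everywhere contains one.
\<close>

definition L2 :: "('a::euclidean_space \<Rightarrow> complex) set" where
  "L2 = {f. f \<in> borel_measurable lborel \<and> integrable lborel (\<lambda>x. (cmod (f x))\<^sup>2)}"

definition L2_norm :: "('a::euclidean_space \<Rightarrow> complex) \<Rightarrow> real" where
  "L2_norm f = sqrt (\<integral>x. (cmod (f x))\<^sup>2 \<partial>lborel)"

definition fourier_integral :: "('a::euclidean_space \<Rightarrow> complex) \<Rightarrow> 'a \<Rightarrow> complex" where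
  "fourier_integral f \<xi> =
     complex_of_real ((2 * pi) powr (- real DIM('a) / 2)) *
     (\<integral>x. f x * exp (- (\<i> * complex_of_real (x \<bullet> \<xi>))) \<partial>lborel)"

text \<open>
  A function in \<open>L\<^sup>2\<close> need not be integrable, so its Fourier transform is the limit in \<open>L\<^sup>2\<close> of the
  Fourier integrals over balls. It is determined up to a null set, hence the choice operator
  below, and equations between transforms are stated almost everywhere. The distance to the limit
  is a nonnegative integral because its value is then \<open>\<infinity>\<close>, and not 0, where it diverges.
\<close>

definition is_fourier_transform ::
    "('a::euclidean_space \<Rightarrow> complex) \<Rightarrow> ('a \<Rightarrow> complex) \<Rightarrow> bool" where
  "is_fourier_transform f F \<longleftrightarrow>
     F \<in> L2 \<and>
     ((\<lambda>R. \<integral>\<^sup>+\<xi>. ennreal ((cmod (F \<xi> - fourier_integral (\<lambda>x. indicator (cball 0 R) x * f x) \<xi>))\<^sup>2)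
          \<partial>lborel) \<longlongrightarrow> 0) at_top"

definition fourier :: "('a::euclidean_space \<Rightarrow> complex) \<Rightarrow> 'a \<Rightarrow> complex" where
  "fourier f = (SOME F. is_fourier_transform f F)"

definition sobolev_weighted :: "real \<Rightarrow> ('a::euclidean_space \<Rightarrow> complex) \<Rightarrow> 'a \<Rightarrow> complex" where
  "sobolev_weighted r f \<xi> = complex_of_real ((1 + (norm \<xi>)\<^sup>2) powr (r / 2)) * fourier f \<xi>"

text \<open>Only for orders \<open>r \<ge> 0\<close>, where \<open>H\<^sup>r\<close> is a subspace of \<open>L\<^sup>2\<close>.\<close>

definition sobolev :: "real \<Rightarrow> ('a::euclidean_space \<Rightarrow> complex) set" where
  "sobolev r = {f \<in> L2. sobolev_weighted r f \<in> L2}"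

definition sobolev_norm :: "real \<Rightarrow> ('a::euclidean_space \<Rightarrow> complex) \<Rightarrow> real" where
  "sobolev_norm r f = L2_norm (sobolev_weighted r f)"

definition mittag_leffler :: "real \<Rightarrow> real \<Rightarrow> real" where
  "mittag_leffler \<gamma> z = (\<Sum>k. z ^ k / Gamma (\<gamma> * real k + 1))"

text \<open>
  Solutions of \<open>\<partial>\<^sub>t\<^sup>\<gamma> u = \<Delta> u\<close>, with the Caputo derivative of order \<open>\<gamma>\<close> in time, are understood
  through their frequency representation. Here \<open>u t\<close> is the function \<open>u(\<cdot>, t)\<close>.
\<close>

definition frac_diffusion_solution ::
    "real \<Rightarrow> real \<Rightarrow> (real \<Rightarrow> 'a::euclidean_space \<Rightarrow> complex) \<Rightarrow> bool" where
  "frac_diffusion_solution \<gamma> T u \<longleftrightarrow>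
     (\<forall>t\<in>{0..T}. u t \<in> L2 \<and>
        (AE \<xi> in lborel. fourier (u t) \<xi> =
           fourier (u 0) \<xi> * complex_of_real (mittag_leffler \<gamma> (- (norm \<xi>)\<^sup>2 * t powr \<gamma>))))"

definition final_value_solution ::
    "real \<Rightarrow> real \<Rightarrow> ('a::euclidean_space \<Rightarrow> complex) \<Rightarrow> (real \<Rightarrow> 'a \<Rightarrow> complex) \<Rightarrow> bool" where
  "final_value_solution \<gamma> T g u \<longleftrightarrow>
     frac_diffusion_solution \<gamma> T u \<and> g \<in> L2 \<and> (AE x in lborel. u T x = g x)"

text \<open>
  The regularized solution is given by its Fourier transform, so it is the function \<open>v t\<close>
  below up to a null set.
\<close>

definition regularized_solution ::
    "real \<Rightarrow> real \<Rightarrow> real \<Rightarrow> real \<Rightarrow> real \<Rightarrow> ('a::euclidean_space \<Rightarrow> complex) \<Rightarrow>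
     (real \<Rightarrow> 'a \<Rightarrow> complex) \<Rightarrow> bool" where
  "regularized_solution \<gamma> T \<tau> s \<alpha> g v \<longleftrightarrow>
     (\<forall>t\<in>{0..T}. v t \<in> L2 \<and>
        (AE \<xi> in lborel. fourier (v t) \<xi> =
           complex_of_real
             (mittag_leffler \<gamma> (- (norm \<xi>)\<^sup>2 * t powr \<gamma>) /
              mittag_leffler \<gamma> (- (norm \<xi>)\<^sup>2 * T powr \<gamma>) *
              exp (- \<tau> * (\<alpha> * norm \<xi>) powr s)) *
           fourier g \<xi>))"

end

theory Submission
  imports Defs "HOL-Probability.Characteristic_Functions"
begin

text \<open>
  Put \<open>u t = E\<^bsub>\<gamma>,1\<^esub>(-t\<^sup>\<gamma>)\<close> and \<open>k t = t\<^bsup>\<gamma>-1\<^esup>/\<Gamma>(\<gamma>)\<close>. Integrating the series against \<open>k\<close> gives the Volterra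
  equation \<open>u + k * u = 1\<close>, and a comparison of \<open>u\<close> with constants in this equation yields a lower bound
  \<open>E\<^bsub>\<gamma>,1\<^esub>(-x) \<ge> c/(1 + x)\<close> for \<open>x \<ge> 0\<close>. So dividing by \<open>E\<^bsub>\<gamma>,1\<^esub>(-|\<xi>|\<^sup>2 T\<^sup>\<gamma>)\<close> costs at most two
  derivatives. With \<open>e = exp (-\<tau>(\<alpha>|\<xi>|)\<^sup>s)\<close> and \<open>M = E\<^bsub>\<gamma>,1\<^esub>(-|\<xi>|\<^sup>2 T\<^sup>\<gamma>)\<close>, the transform of the error at time 0
  is \<open>(1 - e)\<close> times that of \<open>u(0)\<close> plus \<open>e/M\<close> times that of \<open>g - g\<^sup>\<delta>\<close>. The first term is at most
  of order \<open>\<alpha>\<^bsup>p-l\<^esup>E\<close> in the weighted norm, by \<open>1 - exp (-y) \<le> y\<^sup>\<theta>\<close> with \<open>\<theta> = (p - l)/s \<le> 1\<close>, and the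
  second of order \<open>\<alpha>\<^bsup>-(l+2)\<^esup>\<delta>\<close>; the choice of \<open>\<alpha>\<close> balances the two. No more of Plancherel's theorem is
  needed than that the Fourier transform is bounded on \<open>L\<^sup>2\<close>, which follows by damping with
  Gaussians.
\<close>

section \<open>The Mittag-Leffler function on the negative half-line\<close>

text \<open>In Euler's integral only the part over \<open>{M..}\<close> is kept, where
  \<open>t powr y \<ge> M powr y\<close>. The parameter \<open>M\<close> is free: a constant makes
  the Gamma function outgrow a geometric sequence, and \<open>M = \<tau> * y powr s\<close> bounds a
  power of \<open>y\<close> times the filter.\<close>

lemma Gamma_lower_bound:
  fixes M y :: real
  assumes "0 \<le> M" "0 \<le> y"
  shows "M powr y * exp (- M) \<le> Gamma (y + 1)"
proof -
  have G: "((\<lambda>t. t powr y / exp t) has_integral Gamma (y + 1)) {0..}"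
    using Gamma_integral_real[of "y + 1"] assms by simp
  have "((\<lambda>t. M powr y * exp (- t)) has_integral M powr y * exp (- M)) {M..}"
    using has_integral_mult_right[OF has_integral_exp_minus_to_infinity[of 1 M], of "M powr y"] by simp
  then have "((\<lambda>t. if t \<in> {M..} then M powr y * exp (- t) else 0) has_integral M powr y * exp (- M)) {0..}"
    using assms by (subst has_integral_restrict) auto
  then show ?thesis
  proof (rule has_integral_le[OF _ G])
    fix t :: real assume "t \<in> {0..}"
    then show "(if t \<in> {M..} then M powr y * exp (- t) else 0) \<le> t powr y / exp t"
      using assms by (auto simp: exp_minus field_simps intro: powr_mono2)
  qed
qed

lemma summable_mittag_leffler:
  fixes \<gamma> x :: real
  assumes "0 < \<gamma>"
  shows "summable (\<lambda>k. x ^ k / Gamma (\<gamma> * real k + 1))"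
proof (rule summable_comparison_test)
  \<comment> \<open>As \<open>M powr \<gamma> = B\<close>, the denominator of index \<open>k\<close>
    is at least \<open>B ^ k * exp (- M)\<close>, while
    \<open>\<bar>x\<bar> / B \<le> 1 / 2\<close>.\<close>
  define B where "B = 2 * (\<bar>x\<bar> + 1)"
  define M where "M = B powr (1 / \<gamma>)"
  have B: "0 < B" using abs_ge_zero[of x] by (simp add: B_def add_nonneg_pos)
  have M: "0 < M" using B by (simp add: M_def)
  have "norm (x ^ k / Gamma (\<gamma> * real k + 1)) \<le> exp M * (1 / 2) ^ k" for k
  proof -
    have "B ^ k * exp (- M) \<le> Gamma (\<gamma> * real k + 1)"
      using Gamma_lower_bound[of M "\<gamma> * real k"] assms M B
      by (simp add: M_def powr_powr powr_realpow)
    moreover have "0 < Gamma (\<gamma> * real k + 1)"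
      using assms by (intro Gamma_real_pos) (simp add: add_nonneg_pos)
    ultimately have "norm (x ^ k / Gamma (\<gamma> * real k + 1)) \<le> \<bar>x\<bar> ^ k / (B ^ k * exp (- M))"
      using B by (auto simp: power_abs intro!: divide_left_mono)
    also have "\<dots> = exp M * (\<bar>x\<bar> / B) ^ k"
      by (simp add: exp_minus power_divide field_simps)
    also have "\<dots> \<le> exp M * (1 / 2) ^ k"
      by (intro mult_left_mono power_mono) (auto simp: B_def field_simps)
    finally show ?thesis .
  qed
  then show "\<exists>N. \<forall>k\<ge>N. norm (x ^ k / Gamma (\<gamma> * real k + 1)) \<le> exp M * (1 / 2) ^ k"
    by blast
  show "summable (\<lambda>k. exp M * (1 / 2) ^ k)"
    by (intro summable_mult summable_geometric) auto
qed

lemma mittag_leffler_sums: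
  "0 < \<gamma> \<Longrightarrow> (\<lambda>k. x ^ k / Gamma (\<gamma> * real k + 1)) sums mittag_leffler \<gamma> x"
  unfolding mittag_leffler_def by (intro summable_sums summable_mittag_leffler)

lemma mittag_leffler_0 [simp]: "mittag_leffler \<gamma> 0 = 1"
proof -
  have "(\<lambda>k. 0 ^ k / Gamma (\<gamma> * real k + 1)) sums (\<Sum>k\<in>{0}. 0 ^ k / Gamma (\<gamma> * real k + 1))"
    by (rule sums_finite) auto
  then show ?thesis unfolding mittag_leffler_def by (simp add: sums_iff)
qed

lemma mittag_leffler_differentiable:
  assumes "0 < \<gamma>"
  obtains D where "(mittag_leffler \<gamma> has_field_derivative D) (at x)"
proof -
  have "((\<lambda>x. \<Sum>n. inverse (Gamma (\<gamma> * real n + 1)) * x ^ n) has_field_derivative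
     (\<Sum>n. diffs (\<lambda>n. inverse (Gamma (\<gamma> * real n + 1))) n * x ^ n)) (at x)"
    using summable_mittag_leffler[OF assms]
    by (intro termdiffs_strong_converges_everywhere) (simp add: field_simps)
  moreover have "(\<lambda>x. \<Sum>n. inverse (Gamma (\<gamma> * real n + 1)) * x ^ n) = mittag_leffler \<gamma>"
    by (auto simp: mittag_leffler_def field_simps)
  ultimately show ?thesis using that by metis
qed

section \<open>Convolution with the kernel: the Volterra equation\<close>

lemma has_integral_powr_convolution:
  fixes a b t :: real
  assumes "0 < a" "0 < b" "0 < t"
  shows "((\<lambda>r. r powr (a - 1) * (t - r) powr (b - 1)) has_integral
           t powr (a + b - 1) * Beta a b) {0..t}"
proof -
  \<comment> \<open>This is the Beta integral over \<open>{0..1}\<close>, stretched to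
    \<open>{0..t}\<close>.\<close>
  have "((\<lambda>r. (r / t) powr (a - 1) * (1 - r / t) powr (b - 1)) has_integral t * Beta a b) {0..t}"
    using has_integral_affinity'[of "\<lambda>x. x powr (a - 1) * (1 - x) powr (b - 1)" "Beta a b" 0 1 "1 / t" 0]
      has_integral_Beta_real[of a b] assms by (simp add: field_simps)
  then have "((\<lambda>r. t powr (a + b - 2) * ((r / t) powr (a - 1) * (1 - r / t) powr (b - 1))) has_integral
       t powr (a + b - 2) * (t * Beta a b)) {0..t}"
    by (rule has_integral_mult_right)
  moreover have "t powr (a + b - 2) * ((r / t) powr (a - 1) * (1 - r / t) powr (b - 1)) =
      r powr (a - 1) * (t - r) powr (b - 1)" if "r \<in> {0..t}" for r
  proof -
    have "(1 - r / t) = (t - r) / t" using assms by (simp add: field_simps)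
    moreover have "t powr (a + b - 2) = t powr (a - 1) * t powr (b - 1)"
      by (simp flip: powr_add)
    ultimately show ?thesis using that assms by (simp add: powr_divide)
  qed
  moreover have "t powr (a + b - 2) * t = t powr (a + b - 1)"
    using assms powr_add[of t "a + b - 2" 1] by simp
  ultimately show ?thesis
    by (subst has_integral_cong[symmetric]) (auto simp flip: mult.assoc)
qed

text \<open>A Beta integral in which \<open>Gamma (\<gamma> * real k + 1)\<close> cancels. Up to the
  factor \<open>- Gamma \<gamma>\<close>, convolution moves each term of the series to the next
  one.\<close>

lemma has_integral_power_convolution:
  fixes \<gamma> t :: real
  assumes "0 < \<gamma>" "0 < t"
  shows "((\<lambda>r. (t - r) powr (\<gamma> - 1) * ((- (r powr \<gamma>)) ^ k / Gamma (\<gamma> * real k + 1))) has_integral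
           - (Gamma \<gamma> * ((- (t powr \<gamma>)) ^ Suc k / Gamma (\<gamma> * real (Suc k) + 1)))) {0..t}"
proof -
  have pos: "0 < Gamma (\<gamma> * real k + 1)"
    using assms by (intro Gamma_real_pos) (simp add: add_nonneg_pos)
  have "((\<lambda>r. (- 1) ^ k / Gamma (\<gamma> * real k + 1) * (r powr (\<gamma> * real k + 1 - 1) * (t - r) powr (\<gamma> - 1))) has_integral
           (- 1) ^ k / Gamma (\<gamma> * real k + 1) * (t powr (\<gamma> * real k + 1 + \<gamma> - 1) * Beta (\<gamma> * real k + 1) \<gamma>)) {0..t}"
    using assms by (intro has_integral_mult_right has_integral_powr_convolution) (auto simp: add_nonneg_pos)
  moreover have "(- 1) ^ k / Gamma (\<gamma> * real k + 1) * (t powr (\<gamma> * real k + 1 + \<gamma> - 1) * Beta (\<gamma> * real k + 1) \<gamma>)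
      = - (Gamma \<gamma> * ((- (t powr \<gamma>)) ^ Suc k / Gamma (\<gamma> * real (Suc k) + 1)))"
  proof -
    have "t powr (\<gamma> * real k + 1 + \<gamma> - 1) = (t powr \<gamma>) ^ Suc k"
      using assms by (subst powr_power) (auto simp: algebra_simps)
    moreover have "(- (t powr \<gamma>)) ^ Suc k = - ((- 1) ^ k * (t powr \<gamma>) ^ Suc k)"
      by (subst power_minus) simp
    moreover have "\<gamma> * real k + 1 + \<gamma> = \<gamma> * real (Suc k) + 1" by (simp add: algebra_simps)
    ultimately show ?thesis using pos by (simp only: Beta_def) (simp add: field_simps)
  qed
  ultimately have I: "((\<lambda>r. (- 1) ^ k / Gamma (\<gamma> * real k + 1) * (r powr (\<gamma> * real k + 1 - 1) * (t - r) powr (\<gamma> - 1))) has_integral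
        - (Gamma \<gamma> * ((- (t powr \<gamma>)) ^ Suc k / Gamma (\<gamma> * real (Suc k) + 1)))) {0..t}"
    by (simp only:)
  show ?thesis
  proof (rule has_integral_spike_finite[OF _ _ I])
    \<comment> \<open>The point 0 is left out because \<open>0 powr 0 = 0\<close> whereas
      \<open>0 ^ 0 = 1\<close>: for \<open>k = 0\<close> the two integrands differ there.\<close>
    show "finite {0::real}" by simp
    fix r assume "r \<in> {0..t} - {0::real}"
    then have "r powr (\<gamma> * real k) = (r powr \<gamma>) ^ k"
      by (simp add: powr_power mult.commute)
    moreover have "(- (r powr \<gamma>)) ^ k = (- 1) ^ k * (r powr \<gamma>) ^ k" by (subst power_minus) simp
    ultimately show "(t - r) powr (\<gamma> - 1) * ((- (r powr \<gamma>)) ^ k / Gamma (\<gamma> * real k + 1)) =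
      (- 1) ^ k / Gamma (\<gamma> * real k + 1) * (r powr (\<gamma> * real k + 1 - 1) * (t - r) powr (\<gamma> - 1))"
      by simp
  qed
qed

text \<open>Dominated convergence for the partial sums; the majorant takes all terms with positive
  sign at the end point \<open>t\<close>. Since every term moves up by one, the limit is the series
  without its initial term 1.\<close>

lemma mittag_leffler_volterra:
  fixes \<gamma> t :: real
  assumes "0 < \<gamma>" "0 < t"
  shows "((\<lambda>r. (t - r) powr (\<gamma> - 1) * mittag_leffler \<gamma> (- (r powr \<gamma>))) has_integral
           Gamma \<gamma> * (1 - mittag_leffler \<gamma> (- (t powr \<gamma>)))) {0..t}"
proof (rule has_integral_dominated_convergence)
  let ?a = "\<lambda>k x. x ^ k / Gamma (\<gamma> * real k + 1)"
  have pos: "0 < Gamma (\<gamma> * real k + 1)" for k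
    using assms by (intro Gamma_real_pos) (simp add: add_nonneg_pos)
  show "((\<lambda>r. \<Sum>k<K. (t - r) powr (\<gamma> - 1) * ?a k (- (r powr \<gamma>))) has_integral
     (\<Sum>k<K. - (Gamma \<gamma> * ?a (Suc k) (- (t powr \<gamma>))))) {0..t}" for K
    by (intro has_integral_sum has_integral_power_convolution assms) auto
  show "(\<lambda>r. (t - r) powr (\<gamma> - 1) * mittag_leffler \<gamma> (t powr \<gamma>)) integrable_on {0..t}"
    \<comment> \<open>For \<open>k = 0\<close> the integrand is the kernel alone.\<close>
    using has_integral_power_convolution[OF assms, of 0]
    by (intro integrable_on_mult_left) (auto simp: has_integral_integrable)
  show "\<forall>r\<in>{0..t}. norm (\<Sum>k<K. (t - r) powr (\<gamma> - 1) * ?a k (- (r powr \<gamma>)))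
      \<le> (t - r) powr (\<gamma> - 1) * mittag_leffler \<gamma> (t powr \<gamma>)" for K
  proof
    fix r assume r: "r \<in> {0..t}"
    have "\<bar>\<Sum>k<K. ?a k (- (r powr \<gamma>))\<bar> \<le> (\<Sum>k<K. \<bar>?a k (- (r powr \<gamma>))\<bar>)" by (rule sum_abs)
    also have "\<dots> \<le> (\<Sum>k<K. ?a k (t powr \<gamma>))"
      using pos r assms
      by (intro sum_mono) (auto simp: power_abs abs_divide less_imp_le intro!: divide_right_mono power_mono powr_mono2)
    also have "\<dots> \<le> mittag_leffler \<gamma> (t powr \<gamma>)"
      unfolding mittag_leffler_def using pos assms
      by (intro sum_le_suminf summable_mittag_leffler) (auto simp: less_imp_le)
    finally show "norm (\<Sum>k<K. (t - r) powr (\<gamma> - 1) * ?a k (- (r powr \<gamma>)))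
      \<le> (t - r) powr (\<gamma> - 1) * mittag_leffler \<gamma> (t powr \<gamma>)"
      unfolding sum_distrib_left[symmetric] real_norm_def abs_mult
      by (intro mult_mono) auto
  qed
  show "\<forall>r\<in>{0..t}. (\<lambda>K. \<Sum>k<K. (t - r) powr (\<gamma> - 1) * ?a k (- (r powr \<gamma>)))
     \<longlonglongrightarrow> (t - r) powr (\<gamma> - 1) * mittag_leffler \<gamma> (- (r powr \<gamma>))"
    unfolding sum_distrib_left[symmetric]
    using mittag_leffler_sums[OF assms(1)] unfolding sums_def
    by (intro ballI tendsto_mult_left)
  have "(\<lambda>k. ?a (Suc k) (- (t powr \<gamma>))) sums (mittag_leffler \<gamma> (- (t powr \<gamma>)) - 1)"
    using mittag_leffler_sums[OF assms(1), of "- (t powr \<gamma>)"] by (subst sums_Suc_iff) simp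
  then have "(\<lambda>k. - (Gamma \<gamma> * ?a (Suc k) (- (t powr \<gamma>)))) sums
      - (Gamma \<gamma> * (mittag_leffler \<gamma> (- (t powr \<gamma>)) - 1))"
    by (intro sums_minus sums_mult)
  then show "(\<lambda>K. \<Sum>k<K. - (Gamma \<gamma> * ?a (Suc k) (- (t powr \<gamma>))))
      \<longlonglongrightarrow> Gamma \<gamma> * (1 - mittag_leffler \<gamma> (- (t powr \<gamma>)))"
    unfolding sums_def by (simp add: algebra_simps)
qed

text \<open>
  On \<open>[0, N]\<close>, where \<open>N\<^sup>\<gamma> = x\<close>, let \<open>u\<close> first meet the barrier \<open>c\<close> at \<open>t\<^sub>0\<close>, and put \<open>w = u - c\<close>, so that
  \<open>k * w = f - w\<close> with \<open>f t = 1 - c - c t\<^sup>\<gamma>/\<Gamma>(\<gamma> + 1)\<close>. Since \<open>k(t\<^sub>0 - r) \<le> (t/t\<^sub>0)\<^bsup>1-\<gamma>\<^esup> k(t - r)\<close> for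
  \<open>r < t < t\<^sub>0\<close>, comparing \<open>(k * w)(t\<^sub>0)\<close> with \<open>(k * w)(t)\<close> as \<open>t\<close> tends to \<open>t\<^sub>0\<close> shows that the derivative
  of \<open>G t = t\<^bsup>1-\<gamma>\<^esup> f t\<close> at \<open>t\<^sub>0\<close> is not positive. But \<open>c\<close> is small enough to make this derivative positive.
\<close>

lemma mittag_leffler_lower_bound:
  fixes \<gamma> x :: real
  assumes "0 < \<gamma>" "\<gamma> < 1" "0 \<le> x"
  shows "((1 - \<gamma>) / 2) / (1 + x / Gamma (\<gamma> + 1)) \<le> mittag_leffler \<gamma> (- x)"
proof (rule ccontr)
  define \<Gamma>1 where "\<Gamma>1 = Gamma (\<gamma> + 1)"
  define c where "c = ((1 - \<gamma>) / 2) / (1 + x / \<Gamma>1)"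
  define u where "u t = mittag_leffler \<gamma> (- (t powr \<gamma>))" for t
  define N where "N = x powr (1 / \<gamma>)"
  assume "\<not> ?thesis"
  then have uN: "u N < c"
    using assms by (simp add: u_def N_def powr_powr c_def \<Gamma>1_def)
  have \<Gamma>1: "0 < \<Gamma>1" unfolding \<Gamma>1_def using assms by (intro Gamma_real_pos) simp
  have Gg: "0 < Gamma \<gamma>" using assms by (intro Gamma_real_pos)
  then have Gn: "Gamma \<gamma> \<noteq> 0" by linarith
  have \<Gamma>1_eq: "\<Gamma>1 = \<gamma> * Gamma \<gamma>"
    unfolding \<Gamma>1_def using assms by (intro Gamma_plus1) (auto elim!: nonpos_Ints_cases)
  \<comment> \<open>The value of \<open>c\<close> is fixed by this identity. It serves twice:
    \<open>c < 1 = u 0\<close>, and the derivative of \<open>G\<close> at \<open>t0\<close> comes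
    out positive.\<close>
  have c: "0 < c" "c + c * x / \<Gamma>1 = (1 - \<gamma>) / 2"
  proof -
    have 1: "0 < 1 + x / \<Gamma>1" using assms \<Gamma>1 by (simp add: add_pos_nonneg)
    then show "0 < c" using assms by (simp add: c_def)
    have "c * (1 + x / \<Gamma>1) = (1 - \<gamma>) / 2" using 1 by (metis c_def nonzero_divide_eq_eq less_irrefl)
    then show "c + c * x / \<Gamma>1 = (1 - \<gamma>) / 2" by (simp add: algebra_simps)
  qed
  have c1: "c \<le> (1 - \<gamma>) / 2"
    using c assms \<Gamma>1 by (smt (verit) divide_nonneg_pos mult_nonneg_nonneg)
  have u0: "u 0 = 1" by (simp add: u_def)
  have "isCont (mittag_leffler \<gamma>) y" for y
    by (rule mittag_leffler_differentiable[OF assms(1), of y]) (rule DERIV_isCont)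
  then have ml_cont: "continuous_on UNIV (mittag_leffler \<gamma>)"
    by (intro continuous_at_imp_continuous_on) auto
  have cont: "continuous_on {0..} u"
    unfolding u_def using assms
    by (intro continuous_on_compose2[OF ml_cont] continuous_intros continuous_on_powr') auto
  define S where "S = {0..N} \<inter> u -` {..c}"
  have "0 \<le> N" by (simp add: N_def)
  then have NS: "N \<in> S" using uN by (simp add: S_def)
  have "closed S"
    unfolding S_def by (intro continuous_closed_preimage continuous_on_subset[OF cont]) auto
  then have "compact S" by (simp add: compact_eq_bounded_closed bounded_subset[of "{0..N}"] S_def)
  then obtain t0 where t0S: "t0 \<in> S" and t0min: "\<And>t. t \<in> S \<Longrightarrow> t0 \<le> t"
    using compact_attains_inf[of S] NS by blast
  \<comment> \<open>Since \<open>u 0 = 1 > c\<close>, the first meeting is not at 0, where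
    \<open>t powr \<gamma>\<close> is not differentiable.\<close>
  have t0: "0 < t0" "t0 \<le> N" "u t0 \<le> c"
    using t0S u0 c1 assms by (auto simp: S_def less_le)
  have above: "c < u t" if "0 \<le> t" "t < t0" for t
    using t0min[of t] that t0 by (force simp: S_def)
  have ut0: "u t0 = c"
  proof (rule antisym[OF t0(3)])
    have "continuous_on {0<..} u" by (rule continuous_on_subset[OF cont]) auto
    then have "(u \<longlongrightarrow> u t0) (at t0)"
      using t0 by (simp add: continuous_on_eq_continuous_at isCont_def)
    then have "(u \<longlongrightarrow> u t0) (at_left t0)" by (rule tendsto_mono[rotated]) (simp add: at_le)
    moreover have "eventually (\<lambda>t. c \<le> u t) (at_left t0)"
      using eventually_at_left_real[OF t0(1)] by eventually_elim (simp add: less_imp_le above)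
    ultimately show "c \<le> u t0" by (intro tendsto_lowerbound) auto
  qed
  define w where "w t = u t - c" for t
  have w: "0 \<le> w t" if "t \<in> {0..t0}" for t
    using that above[of t] ut0 by (cases "t = t0") (auto simp: w_def)
  define f where "f t = 1 - c - c * t powr \<gamma> / \<Gamma>1" for t
  have vol: "((\<lambda>r. (t - r) powr (\<gamma> - 1) * w r) has_integral Gamma \<gamma> * (f t - w t)) {0..t}"
    if "0 < t" for t
  proof -
    have "((\<lambda>r. (t - r) powr (\<gamma> - 1)) has_integral t powr \<gamma> / \<gamma>) {0..t}"
      using has_integral_power_convolution[OF assms(1) that, of 0] \<Gamma>1_eq Gg
      by (simp add: \<Gamma>1_def)
    then have "((\<lambda>r. (t - r) powr (\<gamma> - 1) * u r - (t - r) powr (\<gamma> - 1) * c) has_integral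
       Gamma \<gamma> * (1 - u t) - t powr \<gamma> / \<gamma> * c) {0..t}"
      using mittag_leffler_volterra[OF assms(1) that] unfolding u_def
      by (intro has_integral_diff has_integral_mult_left)
    moreover have "Gamma \<gamma> * (1 - u t) - t powr \<gamma> / \<gamma> * c = Gamma \<gamma> * (f t - w t)"
      using assms by (simp add: f_def w_def \<Gamma>1_eq field_simps Gn)
    moreover have "(\<lambda>r. (t - r) powr (\<gamma> - 1) * w r) =
        (\<lambda>r. (t - r) powr (\<gamma> - 1) * u r - (t - r) powr (\<gamma> - 1) * c)"
      by (simp add: w_def right_diff_distrib)
    ultimately show ?thesis by (simp only:)
  qed
  obtain D where D: "(u has_field_derivative D) (at t0)"
  proof -
    obtain D' where 1: "(mittag_leffler \<gamma> has_field_derivative D') (at (- (t0 powr \<gamma>)))"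
      using mittag_leffler_differentiable[OF assms(1)] .
    have 2: "((\<lambda>t. - (t powr \<gamma>)) has_field_derivative - (\<gamma> * t0 powr (\<gamma> - 1))) (at t0)"
      using t0 by (auto intro!: derivative_eq_intros)
    show ?thesis using that DERIV_chain2[OF 1 2] by (simp add: u_def[abs_def])
  qed
  define L where "L = \<bar>D\<bar> + 1"
  have "((\<lambda>t. (u t - u t0) / (t - t0)) \<longlongrightarrow> D) (at t0)"
    using D by (simp add: DERIV_LIM_iff has_field_derivative_iff)
  then have "eventually (\<lambda>t. dist ((u t - u t0) / (t - t0)) D < 1) (at t0)"
    by (rule tendstoD) simp
  then obtain d where d: "0 < d"
    "\<And>t. t \<noteq> t0 \<Longrightarrow> dist t t0 < d \<Longrightarrow> dist ((u t - u t0) / (t - t0)) D < 1"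
    unfolding eventually_at by auto
  \<comment> \<open>Differentiability makes \<open>w\<close> vanish at least linearly at
    \<open>t0\<close>. This cancels the singularity of the kernel on \<open>{t..t0}\<close>, and the
    integral there is of order \<open>(t0 - t) powr (1 + \<gamma>)\<close>, too small to matter in
    the difference quotient.\<close>
  have wL: "w t \<le> L * (t0 - t)" if "t0 - d < t" "t \<le> t0" for t
  proof (cases "t = t0")
    case False
    have "dist t t0 < d" using that by (simp add: dist_real_def)
    then have "dist ((u t - u t0) / (t - t0)) D < 1" by (rule d(2)[OF False])
    then have "\<bar>(u t - u t0) / (t - t0)\<bar> \<le> L"
      unfolding dist_real_def L_def by linarith
    then have "\<bar>w t\<bar> \<le> L * \<bar>t0 - t\<bar>"
      using False by (simp add: w_def ut0 abs_divide field_simps abs_minus_commute)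
    then show ?thesis using that by auto
  qed (simp add: w_def ut0)
  define G where "G t = (1 - c) * t powr (1 - \<gamma>) - c * t / \<Gamma>1" for t
  have G_eq: "G t = t powr (1 - \<gamma>) * f t" if "0 < t" for t
  proof -
    have "t powr (1 - \<gamma>) * t powr \<gamma> = t" using that by (simp flip: powr_add)
    moreover have "t powr (1 - \<gamma>) * f t = (1 - c) * t powr (1 - \<gamma>) - c * (t powr (1 - \<gamma>) * t powr \<gamma>) / \<Gamma>1"
      by (simp add: f_def algebra_simps)
    ultimately show ?thesis by (simp add: G_def)
  qed
  have key: "(G t - G t0) / (t - t0) \<le> L * t0 powr (1 - \<gamma>) / Gamma \<gamma> * (t0 - t) powr \<gamma>"
    if t: "0 < t" "t0 - d < t" "t < t0" for t
  proof -
    let ?q = "(t / t0) powr (1 - \<gamma>)"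
    let ?k = "\<lambda>r. (t0 - r) powr (\<gamma> - 1) * w r"
    have k: "?k integrable_on {0..t0}" using vol[OF t0(1)] by (rule has_integral_integrable)
    have k1: "?k integrable_on {0..t}" and k2: "?k integrable_on {t..t0}"
      using t by (auto intro: integrable_on_subinterval[OF k])
    have "Gamma \<gamma> * f t0 = integral {0..t0} ?k"
      using vol[OF t0(1)] ut0 by (simp add: integral_unique w_def)
    also have "\<dots> = integral {0..t} ?k + integral {t..t0} ?k"
      using t k by (intro Henstock_Kurzweil_Integration.integral_combine[symmetric]) auto
    also have "integral {0..t} ?k \<le> ?q * (Gamma \<gamma> * (f t - w t))"
    proof (rule has_integral_le[OF integrable_integral[OF k1]])
      let ?h = "\<lambda>r. ?q * ((t - r) powr (\<gamma> - 1) * w r)"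
      \<comment> \<open>At \<open>r = t\<close> the function \<open>?h\<close> is 0, by
        \<open>0 powr (\<gamma> - 1) = 0\<close>, and lies below \<open>?k\<close>; changing this
        one value leaves the integral alone.\<close>
      show "((\<lambda>r. if r = t then ?k t else ?h r) has_integral ?q * (Gamma \<gamma> * (f t - w t))) {0..t}"
        by (rule has_integral_spike_finite[of "{t}", OF _ _ has_integral_mult_right[OF vol[OF t(1)]]]) auto
      fix r assume r: "r \<in> {0..t}"
      have "(t0 - r) powr (\<gamma> - 1) \<le> ?q * (t - r) powr (\<gamma> - 1)" if "r \<noteq> t"
      proof -
        \<comment> \<open>The quotient decreases in \<open>r\<close>, so it is largest at
          \<open>r = 0\<close>; its power gives the comparison of kernels with the factor
          \<open>?q\<close>.\<close>
        have "(t - r) / (t0 - r) \<le> t / t0"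
          using r that t t0 mult_left_mono[of t t0 r] by (simp add: field_simps)
        then have "((t - r) / (t0 - r)) powr (1 - \<gamma>) \<le> ?q"
          using r that t assms by (intro powr_mono2) auto
        then have "((t - r) / (t0 - r)) powr (1 - \<gamma>) * (t - r) powr (\<gamma> - 1) \<le> ?q * (t - r) powr (\<gamma> - 1)"
          by (intro mult_right_mono) auto
        moreover have "((t - r) / (t0 - r)) powr (1 - \<gamma>) * (t - r) powr (\<gamma> - 1) = (t0 - r) powr (\<gamma> - 1)"
        proof -
          have "(t - r) powr (1 - \<gamma>) * (t - r) powr (\<gamma> - 1) = 1"
            using r that by (simp flip: powr_add)
          moreover have "(t0 - r) powr (\<gamma> - 1) = 1 / (t0 - r) powr (1 - \<gamma>)"
            using powr_minus_divide[of "t0 - r" "1 - \<gamma>"] by simp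
          ultimately show ?thesis using r that t by (simp add: powr_divide)
        qed
        ultimately show ?thesis by simp
      qed
      then have "?k r \<le> ?h r" if "r \<noteq> t"
        using that w[of r] r t mult_right_mono[of _ _ "w r"] by (simp flip: mult.assoc)
      then show "?k r \<le> (if r = t then ?k t else ?h r)" by auto
    qed
    also have "\<dots> \<le> ?q * (Gamma \<gamma> * f t)"
      using Gg w[of t] t by (intro mult_left_mono) auto
    also have "integral {t..t0} ?k \<le> integral {t..t0} (\<lambda>r. L * (t0 - t) powr \<gamma>)"
    proof (rule integral_le)
      fix r assume r: "r \<in> {t..t0}"
      have "?k r \<le> (t0 - r) powr (\<gamma> - 1) * (L * (t0 - r))"
        using wL[of r] r t by (intro mult_left_mono) auto
      also have "\<dots> = L * (t0 - r) powr \<gamma>"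
        using r powr_add[of "t0 - r" "\<gamma> - 1" 1] by (cases "r = t0") auto
      also have "\<dots> \<le> L * (t0 - t) powr \<gamma>"
        using r assms by (intro mult_left_mono powr_mono2) (auto simp: L_def)
      finally show "?k r \<le> L * (t0 - t) powr \<gamma>" .
    qed (use k2 in auto)
    also have "\<dots> = L * (t0 - t) powr \<gamma> * (t0 - t)" using t by simp
    finally have "t0 powr (1 - \<gamma>) * (Gamma \<gamma> * f t0) \<le>
        t0 powr (1 - \<gamma>) * (?q * (Gamma \<gamma> * f t) + L * (t0 - t) powr \<gamma> * (t0 - t))"
      by (intro mult_left_mono) auto
    \<comment> \<open>This is why \<open>G\<close> carries the power
      \<open>t powr (1 - \<gamma>)\<close>.\<close>
    moreover have "t0 powr (1 - \<gamma>) * ?q = t powr (1 - \<gamma>)"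
      using t t0 by (simp add: powr_divide)
    ultimately have "Gamma \<gamma> * G t0 \<le> Gamma \<gamma> * G t + L * t0 powr (1 - \<gamma>) * (t0 - t) powr \<gamma> * (t0 - t)"
      using t t0 by (simp add: G_eq algebra_simps)
    then show ?thesis
      using Gg t by (simp add: field_simps)
  qed
  define G' where "G' = (1 - c) * ((1 - \<gamma>) * t0 powr (- \<gamma>)) - c / \<Gamma>1"
  have "(G has_field_derivative G') (at t0)"
    unfolding G_def G'_def using t0 \<Gamma>1 by (auto intro!: derivative_eq_intros)
  then have "((\<lambda>t. (G t - G t0) / (t - t0)) \<longlongrightarrow> G') (at t0)"
    by (simp add: DERIV_LIM_iff has_field_derivative_iff)
  then have "((\<lambda>t. (G t - G t0) / (t - t0)) \<longlongrightarrow> G') (at_left t0)"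
    by (rule tendsto_mono[rotated]) (simp add: at_le)
  moreover have "((\<lambda>t. L * t0 powr (1 - \<gamma>) / Gamma \<gamma> * (t0 - t) powr \<gamma>) \<longlongrightarrow>
      L * t0 powr (1 - \<gamma>) / Gamma \<gamma> * (t0 - t0) powr \<gamma>) (at_left t0)"
  proof (intro tendsto_mult tendsto_const tendsto_powr')
    show "((\<lambda>t. t0 - t) \<longlongrightarrow> t0 - t0) (at_left t0)" by (intro tendsto_intros)
    show "t0 - t0 \<noteq> 0 \<or> 0 < \<gamma> \<and> (\<forall>\<^sub>F t in at_left t0. 0 \<le> t0 - t)"
      using assms eventually_at_left_real[OF t0(1)] by (auto elim: eventually_mono)
  qed
  moreover have "eventually (\<lambda>t. (G t - G t0) / (t - t0) \<le> L * t0 powr (1 - \<gamma>) / Gamma \<gamma> * (t0 - t) powr \<gamma>) (at_left t0)"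
  proof (rule eventually_mono[OF eventually_at_left_real[of "max 0 (t0 - d)" t0]])
    show "max 0 (t0 - d) < t0" using d(1) t0(1) by simp
  qed (rule key; simp)
  ultimately have "G' \<le> L * t0 powr (1 - \<gamma>) / Gamma \<gamma> * (t0 - t0) powr \<gamma>"
    by (intro tendsto_le) auto
  then have "G' \<le> 0" by simp
  \<comment> \<open>For the contradiction: \<open>G'\<close> times \<open>t0 powr \<gamma>\<close>
    is \<open>(1 - c) * (1 - \<gamma>) - c * t0 powr \<gamma> / \<Gamma>1\<close>, and
    \<open>t0 \<le> N\<close> bounds the subtracted term by
    \<open>(1 - \<gamma>) / 2 - c\<close>.\<close>
  have "t0 powr \<gamma> \<le> x"
    using powr_mono2[of \<gamma> t0 N] t0 assms by (simp add: N_def powr_powr)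
  then have "c * t0 powr \<gamma> / \<Gamma>1 \<le> (1 - \<gamma>) / 2 - c"
    using c \<Gamma>1 divide_right_mono[OF mult_left_mono[of "t0 powr \<gamma>" x c], of \<Gamma>1] by linarith
  also have "\<dots> < (1 - c) * (1 - \<gamma>)"
  proof -
    have "c * (1 - \<gamma>) < c" using c assms by simp
    moreover have "0 < (1 - \<gamma>) / 2" using assms by simp
    ultimately have "c * (1 - \<gamma>) < c + (1 - \<gamma>) / 2" by linarith
    then show ?thesis by (subst left_diff_distrib) linarith
  qed
  finally have "0 < t0 powr (- \<gamma>) * ((1 - c) * (1 - \<gamma>) - c * t0 powr \<gamma> / \<Gamma>1)"
    using t0 by simp
  also have "\<dots> = (1 - c) * (1 - \<gamma>) * t0 powr (- \<gamma>) - c * (t0 powr (- \<gamma>) * t0 powr \<gamma>) / \<Gamma>1"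
    by (simp add: algebra_simps)
  also have "\<dots> = G'"
    using t0 by (simp add: G'_def flip: powr_add)
  finally show False using \<open>G' \<le> 0\<close> by simp
qed

text \<open>The inequality \<open>1 + y * q \<le> (1 + q) * (1 + y)\<close> separates
  \<open>b\<close> from \<open>y\<close>. In use \<open>y\<close> is the squared frequency and
  \<open>b = T powr \<gamma>\<close>, so \<open>A\<close> is uniform in the frequency and
  \<open>1 + y\<close> is the loss of two derivatives.\<close>

lemma mittag_leffler_inverse_bound:
  fixes \<gamma> b :: real
  assumes "0 < \<gamma>" "\<gamma> < 1" "0 \<le> b"
  obtains A where "0 < A"
    and "\<And>y. 0 \<le> y \<Longrightarrow> 0 < mittag_leffler \<gamma> (- (y * b)) \<and> 1 / mittag_leffler \<gamma> (- (y * b)) \<le> A * (1 + y)"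
proof
  define G where "G = Gamma (\<gamma> + 1)"
  define c where "c = (1 - \<gamma>) / 2"
  have G: "0 < G" unfolding G_def using assms by (intro Gamma_real_pos) simp
  have c: "0 < c" using assms by (simp add: c_def)
  have bG: "0 \<le> b / G" using assms G by simp
  show "0 < (1 + b / G) / c" using bG c by (intro divide_pos_pos) linarith+
  fix y :: real assume y: "0 \<le> y"
  have nn: "0 \<le> y * (b / G)" using y bG by (rule mult_nonneg_nonneg)
  define M where "M = mittag_leffler \<gamma> (- (y * b))"
  have le: "c / (1 + y * (b / G)) \<le> M"
    using mittag_leffler_lower_bound[OF assms(1,2), of "y * b"] y assms
    by (simp add: M_def c_def G_def)
  have "0 < c / (1 + y * (b / G))" using nn c by (intro divide_pos_pos) linarith+
  then have M: "0 < M" using le by linarith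
  have "1 / M \<le> (1 + y * (b / G)) / c"
  proof -
    have "c \<le> M * (1 + y * (b / G))" using le nn by (subst pos_divide_le_eq[symmetric]) auto
    then show ?thesis using M c by (simp add: pos_divide_le_eq pos_le_divide_eq mult_ac)
  qed
  also have "\<dots> \<le> (1 + b / G) * (1 + y) / c"
  proof (rule divide_right_mono)
    have "1 + y * q \<le> (1 + q) * (1 + y)" if "0 \<le> q" for q
      using y that by (simp add: algebra_simps)
    then show "1 + y * (b / G) \<le> (1 + b / G) * (1 + y)" using bG .
  qed (use c in simp)
  finally show "0 < mittag_leffler \<gamma> (- (y * b)) \<and> 1 / mittag_leffler \<gamma> (- (y * b)) \<le> (1 + b / G) / c * (1 + y)"
    using M by (simp add: M_def)
qed

section \<open>Plancherel's inequality for integrable functions\<close>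

lemma borel_measurable_cnj [measurable]: "cnj \<in> borel_measurable borel"
  by (intro borel_measurable_continuous_onI continuous_intros)

text \<open>\<open>lborel\<close> is the image of a product of one-dimensional Lebesgue measures
  under the coordinate map, so this is Fubini's theorem. It reduces Gaussian integrals to dimension
  one.\<close>

lemma integral_lborel_prod:
  fixes f :: "'a::euclidean_space \<Rightarrow> real \<Rightarrow> complex"
  assumes "\<And>b. b \<in> Basis \<Longrightarrow> integrable lborel (f b)"
  shows "(\<integral>x. (\<Prod>b\<in>Basis. f b (x \<bullet> b)) \<partial>lborel) = (\<Prod>b\<in>Basis. (\<integral>x. f b x \<partial>lborel))"
    and "integrable lborel (\<lambda>x. \<Prod>b\<in>Basis. f b (x \<bullet> b))"
proof -
  interpret product_sigma_finite "\<lambda>_::'a. lborel :: real measure" ..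
  have [measurable]: "f b \<in> borel_measurable borel" if "b \<in> Basis" for b
    using borel_measurable_integrable[OF assms[OF that]] by simp
  have m: "(\<lambda>x. \<Prod>b\<in>Basis. f b (x \<bullet> b)) \<in> borel_measurable borel"
    by measurable
  have T: "(\<lambda>g. \<Sum>b\<in>Basis. g b *\<^sub>R b) \<in> (\<Pi>\<^sub>M b\<in>Basis. lborel) \<rightarrow>\<^sub>M (borel :: 'a measure)"
    by measurable
  have e: "(\<Prod>b\<in>Basis. f b ((\<Sum>b'\<in>Basis. g b' *\<^sub>R b') \<bullet> b)) = (\<Prod>b\<in>Basis. f b (g b))" for g
    by (intro prod.cong) auto
  show "(\<integral>x. (\<Prod>b\<in>Basis. f b (x \<bullet> b)) \<partial>lborel) = (\<Prod>b\<in>Basis. (\<integral>x. f b x \<partial>lborel))"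
    unfolding lborel_eq[where 'a='a] using assms
    by (subst integral_distr[OF T m], simp only: e) (intro product_integral_prod; simp)
  show "integrable lborel (\<lambda>x. \<Prod>b\<in>Basis. f b (x \<bullet> b))"
    unfolding lborel_eq[where 'a='a] using assms
    by (subst integrable_distr_eq[OF T m], simp only: e) (intro product_integrable_prod; simp)
qed

section \<open>Gaussians and the heat kernel\<close>

lemma fourier_gaussian_real:
  fixes \<epsilon> z :: real
  assumes "0 < \<epsilon>"
  defines "f \<equiv> \<lambda>x. complex_of_real (exp (- (\<epsilon>\<^sup>2 * x\<^sup>2 / 2))) * exp (- (\<i> * complex_of_real (z * x)))"
  shows "integrable lborel f"
    and "integral\<^sup>L lborel f = complex_of_real (2 * pi * normal_density 0 \<epsilon> z)"
proof -
  \<comment> \<open>Up to scaling, \<open>f\<close> is a standard normal density times a character,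
    so its integral is a value of the characteristic function of that distribution. The form
    \<open>0 + \<epsilon> * x\<close> fits the rules for affine substitution.\<close>
  have n: "exp (- (\<epsilon>\<^sup>2 * x\<^sup>2 / 2)) = sqrt (2 * pi) * std_normal_density (0 + \<epsilon> * x)" for x
    by (simp add: std_normal_density_def power_mult_distrib)
  have "integrable lborel (\<lambda>x. sqrt (2 * pi) * std_normal_density (0 + \<epsilon> * x))"
    using assms by (intro integrable_mult_right lborel_integrable_real_affine) auto
  then have i: "integrable lborel (\<lambda>x. exp (- (\<epsilon>\<^sup>2 * x\<^sup>2 / 2)))" by (simp only: n)
  show "integrable lborel f"
    by (rule Bochner_Integration.integrable_bound[OF i]) (auto simp: f_def norm_mult)
  define g where "g y = std_normal_density y *\<^sub>R iexp ((- z / \<epsilon>) * y)" for y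
  have "integral\<^sup>L lborel g = char std_normal_distribution (- z / \<epsilon>)"
    unfolding char_def g_def by (subst integral_density) auto
  also have "\<dots> = complex_of_real (exp (- (z / \<epsilon>)\<^sup>2 / 2))"
    by (simp add: char_std_normal_distribution)
  finally have "complex_of_real (exp (- (z / \<epsilon>)\<^sup>2 / 2)) = \<epsilon> *\<^sub>R (\<integral>x. g (0 + \<epsilon> * x) \<partial>lborel)"
    using lborel_integral_real_affine[of \<epsilon> g 0] assms by simp
  moreover have "f x = sqrt (2 * pi) *\<^sub>R g (0 + \<epsilon> * x)" for x
    unfolding f_def n g_def using assms by (simp add: scaleR_conv_of_real)
  then have "f = (\<lambda>x. sqrt (2 * pi) *\<^sub>R g (0 + \<epsilon> * x))" by blast
  then have "integral\<^sup>L lborel f = sqrt (2 * pi) *\<^sub>R (\<integral>x. g (0 + \<epsilon> * x) \<partial>lborel)"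
    by simp
  ultimately have "\<epsilon> *\<^sub>R integral\<^sup>L lborel f = complex_of_real (sqrt (2 * pi) * exp (- (z / \<epsilon>)\<^sup>2 / 2))"
    by (simp add: scaleR_conv_of_real)
  moreover have "\<epsilon> * (2 * pi * normal_density 0 \<epsilon> z) = sqrt (2 * pi) * exp (- (z / \<epsilon>)\<^sup>2 / 2)"
  proof -
    have "sqrt (2 * pi * \<epsilon>\<^sup>2) = sqrt (2 * pi) * \<epsilon>" using assms by (simp add: real_sqrt_mult)
    moreover have "2 * pi / sqrt (2 * pi) = sqrt (2 * pi)" by (simp add: real_div_sqrt)
    ultimately show ?thesis
      using assms by (simp add: normal_density_def power_divide field_simps)
  qed
  ultimately have "\<epsilon> *\<^sub>R integral\<^sup>L lborel f = \<epsilon> *\<^sub>R complex_of_real (2 * pi * normal_density 0 \<epsilon> z)"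
    by (simp add: scaleR_conv_of_real flip: of_real_mult)
  then show "integral\<^sup>L lborel f = complex_of_real (2 * pi * normal_density 0 \<epsilon> z)"
    using assms by simp
qed

text \<open>The kernel of the heat equation at time \<open>\<epsilon>\<^sup>2 / 2\<close>, written
  as a product so that its mass and its role as a transform can be computed coordinatewise.\<close>

definition heat_kernel :: "real \<Rightarrow> 'a::euclidean_space \<Rightarrow> real" where
  "heat_kernel \<epsilon> z = (\<Prod>b\<in>Basis. normal_density 0 \<epsilon> (z \<bullet> b))"

lemma heat_kernel_nonneg: "0 \<le> heat_kernel \<epsilon> z"
  by (simp add: heat_kernel_def prod_nonneg)

lemma heat_kernel_minus: "heat_kernel \<epsilon> (- z) = heat_kernel \<epsilon> z"
  by (simp add: heat_kernel_def normal_density_def)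

lemma borel_measurable_heat_kernel [measurable]: "heat_kernel \<epsilon> \<in> borel_measurable borel"
  unfolding heat_kernel_def by measurable

lemma nn_integral_heat_kernel:
  fixes y :: "'a::euclidean_space"
  assumes "0 < \<epsilon>"
  shows "(\<integral>\<^sup>+x. ennreal (heat_kernel \<epsilon> (x - y)) \<partial>lborel) = 1"
proof -
  have 1: "(\<integral>\<^sup>+x. ennreal (normal_density 0 \<epsilon> x) \<partial>lborel) = 1"
    using assms by (subst nn_integral_eq_integral) auto
  have "(\<integral>\<^sup>+x. ennreal (heat_kernel \<epsilon> (x - y)) \<partial>lborel) =
      (\<integral>\<^sup>+x. ennreal (heat_kernel \<epsilon> (x - y)) \<partial>distr lborel borel ((+) y))"
    by (simp add: lborel_distr_plus)
  also have "\<dots> = (\<integral>\<^sup>+x. ennreal (heat_kernel \<epsilon> (x::'a)) \<partial>lborel)"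
    by (subst nn_integral_distr) auto
  also have "\<dots> = (\<integral>\<^sup>+x. (\<Prod>b\<in>Basis. ennreal (normal_density 0 \<epsilon> ((x::'a) \<bullet> b))) \<partial>lborel)"
    by (simp add: heat_kernel_def prod_ennreal)
  also have "\<dots> = 1"
    using nn_integral_lborel_prod[of "\<lambda>_::'a. \<lambda>x. ennreal (normal_density 0 \<epsilon> x)"] by (simp add: 1)
  finally show ?thesis .
qed

text \<open>The Gaussian and the character both factor over the coordinates. The exponential
  integral is taken without normalization, hence the full power of \<open>2 * pi\<close>.\<close>

lemma fourier_gaussian:
  fixes z :: "'a::euclidean_space"
  assumes "0 < \<epsilon>"
  defines "f \<equiv> \<lambda>\<xi>. complex_of_real (exp (- (\<epsilon>\<^sup>2 * (norm \<xi>)\<^sup>2 / 2))) * exp (- (\<i> * complex_of_real (z \<bullet> \<xi>)))"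
  shows "integrable lborel f"
    and "integral\<^sup>L lborel f = complex_of_real ((2 * pi) ^ DIM('a) * heat_kernel \<epsilon> z)"
proof -
  define g where "g b x = complex_of_real (exp (- (\<epsilon>\<^sup>2 * x\<^sup>2 / 2))) *
      exp (- (\<i> * complex_of_real ((z \<bullet> b) * x)))" for b x
  have f: "f = (\<lambda>\<xi>. \<Prod>b\<in>Basis. g b (\<xi> \<bullet> b))"
  proof
    fix \<xi> :: 'a
    have "(norm \<xi>)\<^sup>2 = (\<Sum>b\<in>Basis. (\<xi> \<bullet> b)\<^sup>2)"
      unfolding power2_norm_eq_inner by (subst euclidean_inner) (simp add: power2_eq_square)
    then have "exp (- (\<epsilon>\<^sup>2 * (norm \<xi>)\<^sup>2 / 2)) = (\<Prod>b\<in>Basis. exp (- (\<epsilon>\<^sup>2 * (\<xi> \<bullet> b)\<^sup>2 / 2)))"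
      by (simp add: exp_sum sum_distrib_left sum_divide_distrib flip: sum_negf)
    moreover have "exp (- (\<i> * complex_of_real (z \<bullet> \<xi>))) = (\<Prod>b\<in>Basis. exp (- (\<i> * complex_of_real ((z \<bullet> b) * (\<xi> \<bullet> b)))))"
      by (subst euclidean_inner) (simp add: exp_sum sum_distrib_left flip: sum_negf)
    ultimately show "f \<xi> = (\<Prod>b\<in>Basis. g b (\<xi> \<bullet> b))"
      by (simp add: f_def g_def prod.distrib)
  qed
  have g: "integrable lborel (g b)" "integral\<^sup>L lborel (g b) = complex_of_real (2 * pi * normal_density 0 \<epsilon> (z \<bullet> b))" for b
    using fourier_gaussian_real[OF assms(1), of "z \<bullet> b"] by (simp_all add: g_def[abs_def])
  show "integrable lborel f" unfolding f by (intro integral_lborel_prod g)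
  have "integral\<^sup>L lborel f = (\<Prod>b\<in>Basis. integral\<^sup>L lborel (g b))"
    unfolding f by (intro integral_lborel_prod g)
  then show "integral\<^sup>L lborel f = complex_of_real ((2 * pi) ^ DIM('a) * heat_kernel \<epsilon> z)"
    unfolding g by (simp add: heat_kernel_def prod.distrib)
qed

text \<open>A function that is not integrable has Bochner integral 0 by convention, so the bound
  covers it as well.\<close>

lemma norm_integral_le_nn_integral:
  fixes f :: "'a \<Rightarrow> 'b::{banach, second_countable_topology}"
  shows "ennreal (norm (integral\<^sup>L M f)) \<le> (\<integral>\<^sup>+x. ennreal (norm (f x)) \<partial>M)"
  by (cases "integrable M f") (auto simp: integral_norm_bound_ennreal not_integrable_integral_eq)

text \<open>This is Schur's test: the kernel has mass 1 in each variable.\<close>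

lemma norm_heat_form_le:
  fixes f :: "'a::euclidean_space \<Rightarrow> complex"
  assumes [measurable]: "f \<in> borel_measurable borel" and \<epsilon>: "0 < \<epsilon>"
  shows "ennreal (cmod (\<integral>y. cnj (f y) * (\<integral>x. f x * complex_of_real (heat_kernel \<epsilon> (x - y)) \<partial>lborel) \<partial>lborel))
    \<le> (\<integral>\<^sup>+x. ennreal ((cmod (f x))\<^sup>2) \<partial>lborel)" (is "?L \<le> ?R")
proof -
  let ?N = "\<lambda>x y :: 'a. ennreal (heat_kernel \<epsilon> (x - y))"
  let ?h = "\<lambda>x. ennreal ((cmod (f x))\<^sup>2 / 2)"
  have "?L \<le> (\<integral>\<^sup>+y. ennreal (cmod (cnj (f y) * (\<integral>x. f x * complex_of_real (heat_kernel \<epsilon> (x - y)) \<partial>lborel))) \<partial>lborel)"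
    by (rule norm_integral_le_nn_integral)
  also have "\<dots> \<le> (\<integral>\<^sup>+y. \<integral>\<^sup>+x. (?h x * ?N x y + ?h y * ?N x y) \<partial>lborel \<partial>lborel)"
  proof (rule nn_integral_mono)
    fix y
    have "ennreal (cmod (cnj (f y) * (\<integral>x. f x * complex_of_real (heat_kernel \<epsilon> (x - y)) \<partial>lborel))) \<le>
        ennreal (cmod (f y)) * (\<integral>\<^sup>+x. ennreal (cmod (f x * complex_of_real (heat_kernel \<epsilon> (x - y)))) \<partial>lborel)"
      unfolding norm_mult complex_mod_cnj
      by (subst ennreal_mult) (auto intro!: mult_left_mono norm_integral_le_nn_integral[THEN order_trans] simp: norm_mult)
    also have "\<dots> = (\<integral>\<^sup>+x. ennreal (cmod (f y)) * ennreal (cmod (f x * complex_of_real (heat_kernel \<epsilon> (x - y)))) \<partial>lborel)"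
      by (subst nn_integral_cmult) auto
    also have "\<dots> \<le> (\<integral>\<^sup>+x. (?h x * ?N x y + ?h y * ?N x y) \<partial>lborel)"
    proof (rule nn_integral_mono)
      fix x
      \<comment> \<open>This splits the form into two terms, each containing \<open>f\<close> at one
        variable only, so that the kernel can be integrated out in the other.\<close>
      have "2 * (cmod (f y) * cmod (f x)) \<le> (cmod (f x))\<^sup>2 + (cmod (f y))\<^sup>2"
        using sum_squares_bound[of "cmod (f x)" "cmod (f y)"] by (simp add: mult_ac)
      then have "cmod (f y) * cmod (f x) * heat_kernel \<epsilon> (x - y) \<le> ((cmod (f x))\<^sup>2 / 2 + (cmod (f y))\<^sup>2 / 2) * heat_kernel \<epsilon> (x - y)"
        by (intro mult_right_mono heat_kernel_nonneg) simp
      then show "ennreal (cmod (f y)) * ennreal (cmod (f x * complex_of_real (heat_kernel \<epsilon> (x - y)))) \<le> ?h x * ?N x y + ?h y * ?N x y"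
        using heat_kernel_nonneg[of \<epsilon> "x - y"]
        by (simp add: norm_mult ring_distribs mult.assoc flip: ennreal_mult ennreal_plus)
    qed
    finally show "ennreal (cmod (cnj (f y) * (\<integral>x. f x * complex_of_real (heat_kernel \<epsilon> (x - y)) \<partial>lborel)))
      \<le> (\<integral>\<^sup>+x. (?h x * ?N x y + ?h y * ?N x y) \<partial>lborel)" .
  qed
  also have "\<dots> = (\<integral>\<^sup>+y. \<integral>\<^sup>+x. ?h x * ?N x y \<partial>lborel \<partial>lborel) + (\<integral>\<^sup>+y. \<integral>\<^sup>+x. ?h y * ?N x y \<partial>lborel \<partial>lborel)"
    by (simp add: nn_integral_add)
  also have "(\<integral>\<^sup>+y. \<integral>\<^sup>+x. ?h x * ?N x y \<partial>lborel \<partial>lborel) = (\<integral>\<^sup>+x. \<integral>\<^sup>+y. ?h x * ?N x y \<partial>lborel \<partial>lborel)"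
    by (rule lborel_pair.Fubini') measurable
  also have "\<dots> = (\<integral>\<^sup>+x. ?h x \<partial>lborel)"
  proof (rule nn_integral_cong)
    fix x
    have "?N x y = ?N y x" for y using heat_kernel_minus[of \<epsilon> "x - y"] by simp
    then show "(\<integral>\<^sup>+y. ?h x * ?N x y \<partial>lborel) = ?h x"
      using nn_integral_heat_kernel[OF \<epsilon>, of x] by (subst nn_integral_cmult) auto
  qed
  also have "(\<integral>\<^sup>+y. \<integral>\<^sup>+x. ?h y * ?N x y \<partial>lborel \<partial>lborel) = (\<integral>\<^sup>+x. ?h x \<partial>lborel)"
    by (subst nn_integral_cmult) (auto simp: nn_integral_heat_kernel[OF \<epsilon>])
  also have "(\<integral>\<^sup>+x. ?h x \<partial>lborel) + (\<integral>\<^sup>+x. ?h x \<partial>lborel) = ?R"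
    by (subst nn_integral_add[symmetric]) (auto simp flip: ennreal_plus)
  finally show ?thesis .
qed

section \<open>Plancherel's inequality by Gaussian damping\<close>

lemma borel_measurable_fourier_integral [measurable]:
  assumes [measurable]: "f \<in> borel_measurable borel"
  shows "fourier_integral f \<in> borel_measurable borel"
  unfolding fourier_integral_def[abs_def] by measurable

lemma norm_fourier_integral_le:
  fixes f :: "'a::euclidean_space \<Rightarrow> complex"
  shows "cmod (fourier_integral f \<xi>) \<le> (2 * pi) powr (- real DIM('a) / 2) * (\<integral>x. cmod (f x) \<partial>lborel)"
  unfolding fourier_integral_def norm_mult
  by (auto intro!: mult_left_mono integral_norm_bound[THEN order_trans] simp: norm_mult)

text \<open>As \<open>K\<close> is unimodular, the integrand on the product space has the modulus of
  \<open>a x * b y\<close>, which is integrable. In use \<open>K\<close> is a character or its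
  conjugate.\<close>

lemma Fubini_unimodular:
  fixes a b :: "'a::euclidean_space \<Rightarrow> complex"
  assumes a: "integrable lborel a" and b: "integrable lborel b"
    and K[measurable]: "(\<lambda>(x, y). K x y) \<in> borel_measurable (borel \<Otimes>\<^sub>M borel)" and 1: "\<And>x y. cmod (K x y) = 1"
  shows "(\<integral>x. a x * (\<integral>y. b y * K x y \<partial>lborel) \<partial>lborel) = (\<integral>y. b y * (\<integral>x. a x * K x y \<partial>lborel) \<partial>lborel)"
proof -
  have [measurable]: "a \<in> borel_measurable borel" "b \<in> borel_measurable borel"
    using a b by auto
  have K1[measurable]: "K x \<in> borel_measurable borel" for x
    using measurable_compose[OF measurable_Pair1'[of x borel borel] K] by simp
  have K2[measurable]: "(\<lambda>p. K (fst p) (snd p)) \<in> borel_measurable (lborel \<Otimes>\<^sub>M lborel)"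
    using K by (simp add: case_prod_beta' cong: measurable_cong_sets)
  have "integrable (lborel \<Otimes>\<^sub>M lborel) (\<lambda>(x, y). a x * (b y * K x y))"
    unfolding case_prod_beta'
  proof (rule lborel_pair.Fubini_integrable)
    show "(\<lambda>p. a (fst p) * (b (snd p) * K (fst p) (snd p))) \<in> borel_measurable (lborel \<Otimes>\<^sub>M lborel)"
      by measurable
    show "integrable lborel (\<lambda>x. \<integral>y. norm (a (fst (x, y)) * (b (snd (x, y)) * K (fst (x, y)) (snd (x, y)))) \<partial>lborel)"
      using a b by (simp add: norm_mult 1)
    show "AE x in lborel. integrable lborel (\<lambda>y. a (fst (x, y)) * (b (snd (x, y)) * K (fst (x, y)) (snd (x, y))))"
      by (intro AE_I2, simp, intro integrable_mult_right Bochner_Integration.integrable_bound[OF b]) (auto simp: norm_mult 1)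
  qed
  then have "(\<integral>y. (\<integral>x. a x * (b y * K x y) \<partial>lborel) \<partial>lborel) = (\<integral>x. (\<integral>y. a x * (b y * K x y) \<partial>lborel) \<partial>lborel)"
    by (rule lborel_pair.Fubini_integral)
  moreover have "(\<integral>x. a x * (b y * K x y) \<partial>lborel) = b y * (\<integral>x. a x * K x y \<partial>lborel)" for y
    by (subst integral_mult_right_zero[symmetric]) (simp add: mult_ac)
  ultimately show ?thesis by simp
qed

text \<open>The transform \<open>F\<close> is bounded, so the damping makes the integrals over the
  frequency absolutely convergent and allows the frequency to be integrated out first. The Gaussian
  then becomes the heat kernel, and the damped norm becomes the quadratic form of
  \<open>norm_heat_form_le\<close>.\<close>

lemma nn_integral_fourier_integral_damped_le:
  fixes f :: "'a::euclidean_space \<Rightarrow> complex"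
  assumes f: "integrable lborel f" and \<epsilon>: "0 < \<epsilon>"
  shows "(\<integral>\<^sup>+\<xi>. ennreal ((cmod (fourier_integral f \<xi>))\<^sup>2 * exp (- (\<epsilon>\<^sup>2 * (norm \<xi>)\<^sup>2 / 2))) \<partial>lborel)
    \<le> (\<integral>\<^sup>+x. ennreal ((cmod (f x))\<^sup>2) \<partial>lborel)"
proof -
  define F where "F = fourier_integral f"
  define h where "h \<xi> = exp (- (\<epsilon>\<^sup>2 * (norm (\<xi>::'a))\<^sup>2 / 2))" for \<xi>
  define c where "c = complex_of_real ((2 * pi) powr (- real DIM('a) / 2))"
  define e where "e x \<xi> = exp (- (\<i> * complex_of_real (x \<bullet> (\<xi>::'a))))" for x \<xi>
  have [measurable]: "f \<in> borel_measurable borel" using f by auto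
  have [measurable]: "F \<in> borel_measurable borel" unfolding F_def by measurable
  have [measurable]: "(\<lambda>(x, y). e x y) \<in> borel_measurable (borel \<Otimes>\<^sub>M borel)"
    "(\<lambda>(x, y). e y x) \<in> borel_measurable (borel \<Otimes>\<^sub>M borel)"
    unfolding e_def by measurable
  have [measurable]: "e x \<in> borel_measurable borel" "(\<lambda>x. e x y) \<in> borel_measurable borel" for x y
    unfolding e_def by measurable
  have [measurable]: "h \<in> borel_measurable borel" unfolding h_def by measurable
  have e1: "cmod (e x \<xi>) = 1" for x \<xi> by (simp add: e_def)
  have F: "F \<xi> = c * (\<integral>x. f x * e x \<xi> \<partial>lborel)" for \<xi>
    by (simp add: F_def fourier_integral_def c_def e_def)
  have cF: "cnj (F \<xi>) = c * (\<integral>y. cnj (f y) * cnj (e y \<xi>) \<partial>lborel)" for \<xi>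
  proof -
    have "(\<integral>y. cnj (f y) * cnj (e y \<xi>) \<partial>lborel) = (\<integral>y. cnj (f y * e y \<xi>) \<partial>lborel)"
      by (simp only: complex_cnj_mult)
    also have "\<dots> = cnj (\<integral>y. f y * e y \<xi> \<partial>lborel)" by (rule Bochner_Integration.integral_cnj)
    finally show ?thesis by (simp add: F c_def)
  qed
  have hi: "integrable lborel (\<lambda>\<xi>. complex_of_real (h \<xi>))"
    using fourier_gaussian(1)[OF \<epsilon>, of "0::'a"] by (simp add: h_def)
  obtain B where B: "\<And>\<xi>. cmod (F \<xi>) \<le> B"
    using norm_fourier_integral_le[of f] unfolding F_def by blast
  have Fhi: "integrable lborel (\<lambda>\<xi>. F \<xi> * complex_of_real (h \<xi>))"
  proof (rule Bochner_Integration.integrable_bound[OF integrable_mult_right[OF hi, of "complex_of_real B"]])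
    show "AE \<xi> in lborel. norm (F \<xi> * complex_of_real (h \<xi>)) \<le> norm (complex_of_real B * complex_of_real (h \<xi>))"
      using B by (auto simp: norm_mult intro!: mult_right_mono order_trans[OF B])
  qed measurable
  have Fhi2: "integrable lborel (\<lambda>\<xi>. F \<xi> * complex_of_real (h \<xi>) * cnj (F \<xi>))"
  proof (rule Bochner_Integration.integrable_bound[OF integrable_mult_right[OF Fhi, of "complex_of_real B"]])
    show "AE \<xi> in lborel. norm (F \<xi> * complex_of_real (h \<xi>) * cnj (F \<xi>)) \<le> norm (complex_of_real B * (F \<xi> * complex_of_real (h \<xi>)))"
      by (auto simp: norm_mult mult.commute[of "\<bar>B\<bar>"] intro!: mult_left_mono order_trans[OF B])
  qed measurable
  have FF: "F \<xi> * complex_of_real (h \<xi>) * cnj (F \<xi>) = complex_of_real ((cmod (F \<xi>))\<^sup>2 * h \<xi>)" for \<xi>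
    unfolding of_real_mult complex_norm_square by (simp only: mult_ac)
  \<comment> \<open>Up to normalization this is the inverse transform of the damped
    \<open>F\<close>, namely \<open>f\<close> smoothed by the heat kernel.\<close>
  have J: "(\<integral>\<xi>. F \<xi> * complex_of_real (h \<xi>) * cnj (e y \<xi>) \<partial>lborel) =
      c * complex_of_real ((2 * pi) ^ DIM('a)) * (\<integral>x. f x * complex_of_real (heat_kernel \<epsilon> (x - y)) \<partial>lborel)" for y
  proof -
    have hei: "integrable lborel (\<lambda>\<xi>. complex_of_real (h \<xi>) * cnj (e y \<xi>))"
      by (rule Bochner_Integration.integrable_bound[OF hi]) (auto simp: norm_mult e1)
    have "(\<integral>\<xi>. F \<xi> * complex_of_real (h \<xi>) * cnj (e y \<xi>) \<partial>lborel) =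
      c * (\<integral>\<xi>. (complex_of_real (h \<xi>) * cnj (e y \<xi>)) * (\<integral>x. f x * e x \<xi> \<partial>lborel) \<partial>lborel)"
      unfolding F by (subst integral_mult_right_zero[symmetric]) (simp add: mult_ac)
    also have "\<dots> = c * (\<integral>x. f x * (\<integral>\<xi>. (complex_of_real (h \<xi>) * cnj (e y \<xi>)) * e x \<xi> \<partial>lborel) \<partial>lborel)"
      by (subst Fubini_unimodular[OF hei f]) (auto simp: e1)
    also have "(\<lambda>x. \<integral>\<xi>. (complex_of_real (h \<xi>) * cnj (e y \<xi>)) * e x \<xi> \<partial>lborel) =
       (\<lambda>x. complex_of_real ((2 * pi) ^ DIM('a) * heat_kernel \<epsilon> (x - y)))"
    proof
      fix x
      have "(complex_of_real (h \<xi>) * cnj (e y \<xi>)) * e x \<xi> =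
        complex_of_real (exp (- (\<epsilon>\<^sup>2 * (norm \<xi>)\<^sup>2 / 2))) * exp (- (\<i> * complex_of_real ((x - y) \<bullet> \<xi>)))" for \<xi>
        by (simp add: h_def e_def exp_cnj inner_diff_left ring_distribs flip: exp_add)
      then show "(\<integral>\<xi>. (complex_of_real (h \<xi>) * cnj (e y \<xi>)) * e x \<xi> \<partial>lborel) =
         complex_of_real ((2 * pi) ^ DIM('a) * heat_kernel \<epsilon> (x - y))"
        using fourier_gaussian(2)[OF \<epsilon>, of "x - y"] by simp
    qed
    also have "c * (\<integral>x. f x * complex_of_real ((2 * pi) ^ DIM('a) * heat_kernel \<epsilon> (x - y)) \<partial>lborel) =
      c * complex_of_real ((2 * pi) ^ DIM('a)) * (\<integral>x. f x * complex_of_real (heat_kernel \<epsilon> (x - y)) \<partial>lborel)"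
      unfolding mult.assoc by (subst (2) integral_mult_right_zero[symmetric]) (simp add: mult_ac)
    finally show ?thesis .
  qed
  \<comment> \<open>The factors \<open>c\<close> of \<open>F\<close> and of its conjugate absorb the
    power of \<open>2 * pi\<close> from the Gaussian integral, which leaves the constant 1.\<close>
  have c2: "c * (c * complex_of_real ((2 * pi) ^ DIM('a))) = 1"
  proof -
    have P: "P powr (- real DIM('a) / 2) * P powr (- real DIM('a) / 2) * P ^ DIM('a) = 1"
      if "0 < P" for P :: real
      using that by (simp add: powr_realpow[symmetric] flip: powr_add)
    have "(2 * pi) powr (- real DIM('a) / 2) * (2 * pi) powr (- real DIM('a) / 2) * (2 * pi) ^ DIM('a) = 1"
      by (rule P) simp
    then show ?thesis
      unfolding c_def by (simp only: mult.assoc flip: of_real_mult) simp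
  qed
  have "(\<integral>\<xi>. F \<xi> * complex_of_real (h \<xi>) * cnj (F \<xi>) \<partial>lborel) =
    c * (\<integral>\<xi>. (F \<xi> * complex_of_real (h \<xi>)) * (\<integral>y. cnj (f y) * cnj (e y \<xi>) \<partial>lborel) \<partial>lborel)"
    unfolding cF by (subst integral_mult_right_zero[symmetric]) (simp add: mult_ac)
  also have "\<dots> = c * (\<integral>y. cnj (f y) * (\<integral>\<xi>. F \<xi> * complex_of_real (h \<xi>) * cnj (e y \<xi>) \<partial>lborel) \<partial>lborel)"
    using f by (subst Fubini_unimodular[OF Fhi]) (auto simp: e1)
  also have "\<dots> = c * (c * complex_of_real ((2 * pi) ^ DIM('a))) *
      (\<integral>y. cnj (f y) * (\<integral>x. f x * complex_of_real (heat_kernel \<epsilon> (x - y)) \<partial>lborel) \<partial>lborel)"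
    unfolding J mult.assoc[of c "c * _"]
    by (subst (3) integral_mult_right_zero[symmetric]) (simp add: mult_ac)
  finally have eq: "(\<integral>\<xi>. complex_of_real ((cmod (F \<xi>))\<^sup>2 * h \<xi>) \<partial>lborel) =
     (\<integral>y. cnj (f y) * (\<integral>x. f x * complex_of_real (heat_kernel \<epsilon> (x - y)) \<partial>lborel) \<partial>lborel)"
    unfolding FF c2 by simp
  have r: "integrable lborel (\<lambda>\<xi>. (cmod (F \<xi>))\<^sup>2 * h \<xi>)"
  proof -
    have "norm (complex_of_real ((cmod (F \<xi>))\<^sup>2 * h \<xi>)) = (cmod (F \<xi>))\<^sup>2 * h \<xi>" for \<xi>
      unfolding norm_of_real by (simp add: h_def)
    then show ?thesis using integrable_norm[OF Fhi2] unfolding FF by simp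
  qed
  have "(\<integral>\<^sup>+\<xi>. ennreal ((cmod (F \<xi>))\<^sup>2 * h \<xi>) \<partial>lborel) = ennreal (\<integral>\<xi>. (cmod (F \<xi>))\<^sup>2 * h \<xi> \<partial>lborel)"
    by (rule nn_integral_eq_integral[OF r]) (simp add: h_def)
  also have "\<dots> = ennreal (cmod (\<integral>\<xi>. complex_of_real ((cmod (F \<xi>))\<^sup>2 * h \<xi>) \<partial>lborel))"
  proof -
    have "0 \<le> (\<integral>\<xi>. (cmod (F \<xi>))\<^sup>2 * h \<xi> \<partial>lborel)"
      by (rule integral_nonneg_AE) (simp add: h_def)
    then show ?thesis unfolding integral_complex_of_real norm_of_real by simp
  qed
  also have "\<dots> \<le> (\<integral>\<^sup>+x. ennreal ((cmod (f x))\<^sup>2) \<partial>lborel)"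
    unfolding eq by (rule norm_heat_form_le) (use \<epsilon> in auto)
  finally show ?thesis unfolding F_def h_def .
qed

text \<open>Fatou's lemma along \<open>\<epsilon> = 1 / (k + 1)\<close> removes the damping.\<close>

lemma nn_integral_fourier_integral_le:
  fixes f :: "'a::euclidean_space \<Rightarrow> complex"
  assumes f: "integrable lborel f"
  shows "(\<integral>\<^sup>+\<xi>. ennreal ((cmod (fourier_integral f \<xi>))\<^sup>2) \<partial>lborel) \<le> (\<integral>\<^sup>+x. ennreal ((cmod (f x))\<^sup>2) \<partial>lborel)"
proof -
  define g where "g k \<xi> = (cmod (fourier_integral f \<xi>))\<^sup>2 * exp (- ((1 / real (Suc k))\<^sup>2 * (norm \<xi>)\<^sup>2 / 2))" for k \<xi>
  have [measurable]: "f \<in> borel_measurable borel" using f by auto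
  have [measurable]: "g k \<in> borel_measurable borel" for k unfolding g_def by measurable
  have "(\<lambda>k. g k \<xi>) \<longlonglongrightarrow> (cmod (fourier_integral f \<xi>))\<^sup>2 * exp (- (0\<^sup>2 * (norm \<xi>)\<^sup>2 / 2))" for \<xi>
    unfolding g_def by (intro tendsto_intros LIMSEQ_Suc[OF lim_1_over_n]) auto
  then have "(\<lambda>k. ennreal (g k \<xi>)) \<longlonglongrightarrow> ennreal ((cmod (fourier_integral f \<xi>))\<^sup>2)" for \<xi>
    by (intro tendsto_ennrealI) simp
  then have "(\<integral>\<^sup>+\<xi>. ennreal ((cmod (fourier_integral f \<xi>))\<^sup>2) \<partial>lborel) = (\<integral>\<^sup>+\<xi>. liminf (\<lambda>k. ennreal (g k \<xi>)) \<partial>lborel)"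
    by (intro nn_integral_cong lim_imp_Liminf[symmetric]) auto
  also have "\<dots> \<le> liminf (\<lambda>k. \<integral>\<^sup>+\<xi>. ennreal (g k \<xi>) \<partial>lborel)"
    by (rule nn_integral_liminf) measurable
  also have "\<dots> \<le> (\<integral>\<^sup>+x. ennreal ((cmod (f x))\<^sup>2) \<partial>lborel)"
    unfolding g_def by (intro Liminf_le always_eventually allI nn_integral_fourier_integral_damped_le f) auto
  finally show ?thesis .
qed

section \<open>The Fourier transform of square integrable functions\<close>

text \<open>The squared norm with values in \<open>ennreal\<close>: it is infinite on measurable
  functions outside \<open>L2\<close>, where \<open>L2_norm\<close> is 0, so limits and Fatou's
  lemma can be used before membership in \<open>L2\<close> is known.\<close>

definition L2_sq :: "('a::euclidean_space \<Rightarrow> complex) \<Rightarrow> ennreal" where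
  "L2_sq f = (\<integral>\<^sup>+x. ennreal ((cmod (f x))\<^sup>2) \<partial>lborel)"

lemma L2_iff: "f \<in> L2 \<longleftrightarrow> f \<in> borel_measurable borel \<and> L2_sq f < \<infinity>"
proof (cases "f \<in> borel_measurable borel")
  case True
  then have [measurable]: "f \<in> borel_measurable borel" .
  have "integrable lborel (\<lambda>x. (cmod (f x))\<^sup>2) \<longleftrightarrow> L2_sq f < \<infinity>"
    unfolding integrable_iff_bounded L2_sq_def by simp
  then show ?thesis using True by (simp add: L2_def)
qed (simp add: L2_def)

lemma L2_measurable [measurable_dest]: "f \<in> L2 \<Longrightarrow> f \<in> borel_measurable borel"
  by (simp add: L2_iff)

lemma L2_sq_eq: "f \<in> L2 \<Longrightarrow> L2_sq f = ennreal ((L2_norm f)\<^sup>2)"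
  unfolding L2_sq_def L2_norm_def L2_def
  by (subst nn_integral_eq_integral) (auto simp: integral_nonneg_AE)

lemma L2_norm_nonneg: "0 \<le> L2_norm f"
  by (simp add: L2_norm_def integral_nonneg_AE)

lemma L2_sq_le_iff: "f \<in> L2 \<Longrightarrow> 0 \<le> c \<Longrightarrow> L2_sq f \<le> ennreal (c\<^sup>2) \<longleftrightarrow> L2_norm f \<le> c"
  using L2_norm_nonneg[of f] by (simp add: L2_sq_eq power_mono_iff)

lemma L2_sq_mono_AE: "(AE x in lborel. cmod (f x) \<le> cmod (g x)) \<Longrightarrow> L2_sq f \<le> L2_sq g"
  unfolding L2_sq_def by (intro nn_integral_mono_AE) (auto elim!: eventually_mono intro!: ennreal_leI power_mono)

text \<open>The inequality \<open>(a + b)\<^sup>2 \<le> 2 * a\<^sup>2 + 2 * b\<^sup>2\<close> stands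
  in for Minkowski's and avoids square roots in \<open>ennreal\<close>, at the price of factors
  2.\<close>

lemma L2_sq_le_add:
  assumes [measurable]: "g \<in> borel_measurable borel" "h \<in> borel_measurable borel"
    and le: "AE x in lborel. cmod (f x) \<le> cmod (g x) + cmod (h x)"
  shows "L2_sq f \<le> 2 * L2_sq g + 2 * L2_sq h"
proof -
  have "L2_sq f \<le> (\<integral>\<^sup>+x. 2 * ennreal ((cmod (g x))\<^sup>2) + 2 * ennreal ((cmod (h x))\<^sup>2) \<partial>lborel)"
    unfolding L2_sq_def
  proof (rule nn_integral_mono_AE, use le in eventually_elim)
    fix x assume "cmod (f x) \<le> cmod (g x) + cmod (h x)"
    then have "(cmod (f x))\<^sup>2 \<le> (cmod (g x) + cmod (h x))\<^sup>2" by (intro power_mono) auto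
    also have "\<dots> \<le> 2 * (cmod (g x))\<^sup>2 + 2 * (cmod (h x))\<^sup>2"
      using sum_squares_bound[of "cmod (g x)" "cmod (h x)"] by (simp add: power2_sum)
    finally have "ennreal ((cmod (f x))\<^sup>2) \<le> ennreal (2 * (cmod (g x))\<^sup>2 + 2 * (cmod (h x))\<^sup>2)"
      by (rule ennreal_leI)
    then show "ennreal ((cmod (f x))\<^sup>2) \<le> 2 * ennreal ((cmod (g x))\<^sup>2) + 2 * ennreal ((cmod (h x))\<^sup>2)"
      by (simp add: ennreal_plus ennreal_mult)
  qed
  also have "\<dots> = 2 * L2_sq g + 2 * L2_sq h"
    unfolding L2_sq_def by (subst nn_integral_add) (auto simp: nn_integral_cmult)
  finally show ?thesis .
qed

lemma L2_sq_scale: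
  assumes [measurable]: "g \<in> borel_measurable borel"
  shows "L2_sq (\<lambda>x. complex_of_real c * g x) = ennreal (c\<^sup>2) * L2_sq g"
  unfolding L2_sq_def norm_mult norm_of_real power_mult_distrib
  by (simp add: ennreal_mult nn_integral_cmult)

lemma L2_diff: "f \<in> L2 \<Longrightarrow> g \<in> L2 \<Longrightarrow> (\<lambda>x. f x - g x) \<in> L2"
proof -
  assume f: "f \<in> L2" and g: "g \<in> L2"
  note [measurable] = L2_measurable[OF f] L2_measurable[OF g]
  have "L2_sq (\<lambda>x. f x - g x) \<le> 2 * L2_sq f + 2 * L2_sq g"
    by (rule L2_sq_le_add) (auto simp: norm_triangle_ineq4)
  also have "\<dots> < \<infinity>" using f g by (simp add: L2_iff ennreal_mult_less_top)
  finally show ?thesis by (simp add: L2_iff)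
qed

section \<open>Truncation to balls\<close>

definition cut :: "real \<Rightarrow> ('a::euclidean_space \<Rightarrow> complex) \<Rightarrow> 'a \<Rightarrow> complex" where
  "cut R f = (\<lambda>x. indicator (cball 0 R) x * f x)"

definition tail :: "('a::euclidean_space \<Rightarrow> complex) \<Rightarrow> real \<Rightarrow> ennreal" where
  "tail f R = L2_sq (\<lambda>x. f x - cut R f x)"

lemma is_fourier_transform_iff:
  "is_fourier_transform f F \<longleftrightarrow>
    F \<in> L2 \<and> ((\<lambda>R. L2_sq (\<lambda>\<xi>. F \<xi> - fourier_integral (cut R f) \<xi>)) \<longlongrightarrow> 0) at_top"
  by (simp add: is_fourier_transform_def L2_sq_def cut_def)

lemma borel_measurable_cut [measurable]:
  fixes f :: "'a::euclidean_space \<Rightarrow> complex"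
  assumes [measurable]: "f \<in> borel_measurable borel"
  shows "cut R f \<in> borel_measurable borel"
proof -
  have [measurable]: "cball (0::'a) R \<in> sets borel" by simp
  show ?thesis unfolding cut_def by measurable
qed

text \<open>On the ball, which has finite measure, the modulus of \<open>f\<close> is at most 1 plus
  its square.\<close>

lemma integrable_cut:
  fixes f :: "'a::euclidean_space \<Rightarrow> complex"
  assumes f: "f \<in> L2"
  shows "integrable lborel (cut R f)"
proof -
  note [measurable] = L2_measurable[OF f]
  have "integrable lborel (\<lambda>x::'a. indicator (cball 0 R) x :: real)"
    using emeasure_compact_finite[of "cball 0 R :: 'a set"]
    by (intro integrable_real_indicator) auto
  moreover have "integrable lborel (\<lambda>x. (cmod (f x))\<^sup>2)" using f by (simp add: L2_def)
  ultimately have i: "integrable lborel (\<lambda>x. indicator (cball 0 R) x + (cmod (f x))\<^sup>2)"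
    by (rule Bochner_Integration.integrable_add)
  show ?thesis
  proof (rule Bochner_Integration.integrable_bound[OF i])
    have "a \<le> 1 + a\<^sup>2" for a :: real
      using sum_squares_bound[of a 1] zero_le_power2[of a] unfolding one_power2 mult_1_right by linarith
    then have "cmod (cut R f x) \<le> indicator (cball 0 R) x + (cmod (f x))\<^sup>2" for x
      by (simp add: cut_def indicator_def norm_mult)
    then show "AE x in lborel. norm (cut R f x) \<le> norm (indicator (cball 0 R) x + (cmod (f x))\<^sup>2)"
      by (auto intro: order_trans)
  qed measurable
qed

lemma fourier_integral_diff:
  assumes "integrable lborel f" "integrable lborel g"
  shows "fourier_integral (\<lambda>x. f x - g x) \<xi> = fourier_integral f \<xi> - fourier_integral g \<xi>"
proof -
  have i: "integrable lborel (\<lambda>x. h x * exp (- (\<i> * complex_of_real (x \<bullet> \<xi>))))"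
    if h: "integrable lborel h" for h :: "'a \<Rightarrow> complex"
  proof (rule Bochner_Integration.integrable_bound[OF h])
    show "(\<lambda>x. h x * exp (- (\<i> * complex_of_real (x \<bullet> \<xi>)))) \<in> borel_measurable lborel"
      using borel_measurable_integrable[OF h] by measurable
  qed (simp add: norm_mult)
  show ?thesis
    unfolding fourier_integral_def left_diff_distrib
    by (subst Bochner_Integration.integral_diff[OF i[OF assms(1)] i[OF assms(2)]]) (simp add: right_diff_distrib)
qed

text \<open>Dominated convergence gives the limit along the integers; monotonicity in the radius
  extends it to real radii.\<close>

lemma tail_tendsto_0:
  fixes f :: "'a::euclidean_space \<Rightarrow> complex"
  assumes f: "f \<in> L2"
  shows "(tail f \<longlongrightarrow> 0) at_top"
proof -
  note [measurable] = L2_measurable[OF f]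
  have "(\<lambda>n. tail f (real n)) \<longlonglongrightarrow> (\<integral>\<^sup>+x. 0 \<partial>(lborel :: 'a measure))"
    unfolding tail_def L2_sq_def
  proof (rule nn_integral_dominated_convergence[where w = "\<lambda>x. ennreal ((cmod (f x))\<^sup>2)"])
    show "(\<integral>\<^sup>+x. ennreal ((cmod (f x))\<^sup>2) \<partial>lborel) < \<infinity>" using f by (simp add: L2_iff L2_sq_def)
    show "AE x in lborel. ennreal ((cmod (f x - cut (real n) f x))\<^sup>2) \<le> ennreal ((cmod (f x))\<^sup>2)" for n
      by (simp add: cut_def indicator_def)
    show "AE x in lborel. (\<lambda>n. ennreal ((cmod (f x - cut (real n) f x))\<^sup>2)) \<longlonglongrightarrow> 0"
    proof (intro AE_I2 tendsto_eventually)
      fix x :: 'a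
      obtain N where "norm x \<le> real N" using real_arch_simple by blast
      then show "\<forall>\<^sub>F n in sequentially. ennreal ((cmod (f x - cut (real n) f x))\<^sup>2) = 0"
        unfolding eventually_sequentially by (intro exI[of _ N]) (auto simp: cut_def indicator_def)
    qed
  qed measurable
  then have lim: "(\<lambda>n. tail f (real n)) \<longlonglongrightarrow> 0" by simp
  have mono: "tail f S \<le> tail f R" if "R \<le> S" for R S
    unfolding tail_def using that by (intro L2_sq_mono_AE AE_I2) (auto simp: cut_def indicator_def)
  show ?thesis
  proof (rule order_tendstoI)
    fix a :: ennreal assume "0 < a"
    then obtain n where "tail f (real n) < a"
      using order_tendstoD(2)[OF lim] by (auto simp: eventually_sequentially)
    then show "eventually (\<lambda>R. tail f R < a) at_top"
      unfolding eventually_at_top_linorder by (intro exI allI impI) (rule le_less_trans[OF mono])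
  qed auto
qed

text \<open>The two truncations differ on a shell outside the smaller ball, so the tail at the
  smaller radius bounds their distance. The sum is a bound symmetric in \<open>R\<close> and
  \<open>S\<close>.\<close>

lemma L2_sq_fourier_cut_diff_le:
  fixes f :: "'a::euclidean_space \<Rightarrow> complex"
  assumes f: "f \<in> L2"
  shows "L2_sq (\<lambda>\<xi>. fourier_integral (cut S f) \<xi> - fourier_integral (cut R f) \<xi>) \<le> tail f S + tail f R"
proof -
  have "L2_sq (\<lambda>\<xi>. fourier_integral (cut S f) \<xi> - fourier_integral (cut R f) \<xi>) \<le> L2_sq (\<lambda>x. cut S f x - cut R f x)"
    using nn_integral_fourier_integral_le[of "\<lambda>x. cut S f x - cut R f x"] integrable_cut[OF f]
    by (simp add: fourier_integral_diff L2_sq_def)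
  also have "\<dots> \<le> max (tail f S) (tail f R)"
  proof (cases "R \<le> S")
    case True
    then have "L2_sq (\<lambda>x. cut S f x - cut R f x) \<le> tail f R"
      unfolding tail_def by (intro L2_sq_mono_AE AE_I2) (auto simp: cut_def indicator_def)
    then show ?thesis by (simp add: le_max_iff_disj)
  next
    case False
    then have "L2_sq (\<lambda>x. cut S f x - cut R f x) \<le> tail f S"
      unfolding tail_def by (intro L2_sq_mono_AE AE_I2) (auto simp: cut_def indicator_def)
    then show ?thesis by (simp add: le_max_iff_disj)
  qed
  also have "\<dots> \<le> tail f S + tail f R" by (simp add: add_increasing add_increasing2)
  finally show ?thesis .
qed

lemma L2_sq_fourier_cut_le:
  assumes f: "f \<in> L2"
  shows "L2_sq (fourier_integral (cut R f)) \<le> L2_sq f"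
proof -
  have "L2_sq (fourier_integral (cut R f)) \<le> L2_sq (cut R f)"
    unfolding L2_sq_def by (rule nn_integral_fourier_integral_le[OF integrable_cut[OF f]])
  also have "\<dots> \<le> L2_sq f"
    by (intro L2_sq_mono_AE AE_I2) (simp add: cut_def indicator_def)
  finally show ?thesis .
qed

text \<open>
  The Fourier integrals over a sequence of balls whose tails decay like \<open>4\<^bsup>-k\<^esup>\<close> converge almost
  everywhere, and Fatou's lemma turns their limit into the limit in \<open>L\<^sup>2\<close>.
\<close>

lemma is_fourier_transform_exists:
  fixes f :: "'a::euclidean_space \<Rightarrow> complex"
  assumes f: "f \<in> L2"
  shows "\<exists>F. is_fourier_transform f F"
proof -
  note [measurable] = L2_measurable[OF f]
  have "\<exists>R. tail f R < ennreal ((1 / 4) ^ k)" for k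
    using order_tendstoD(2)[OF tail_tendsto_0[OF f], of "ennreal ((1 / 4) ^ k)"]
    by (auto simp: eventually_at_top_linorder)
  then obtain r where r: "\<And>k. tail f (r k) < ennreal ((1 / 4) ^ k)" by metis
  define \<Phi> where "\<Phi> k = fourier_integral (cut (r k) f)" for k
  define d where "d k \<xi> = \<Phi> (Suc k) \<xi> - \<Phi> k \<xi>" for k \<xi>
  have [measurable]: "\<Phi> k \<in> borel_measurable borel" for k unfolding \<Phi>_def by measurable
  have [measurable]: "d k \<in> borel_measurable borel" for k unfolding d_def by measurable
  have dk: "L2_sq (d k) \<le> ennreal (2 * (1 / 4) ^ k)" for k
  proof -
    have "L2_sq (d k) \<le> tail f (r (Suc k)) + tail f (r k)"
      unfolding d_def \<Phi>_def by (rule L2_sq_fourier_cut_diff_le[OF f])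
    also have "\<dots> \<le> ennreal ((1 / 4) ^ Suc k) + ennreal ((1 / 4) ^ k)"
      by (intro add_mono less_imp_le r)
    also have "\<dots> = ennreal ((1 / 4) ^ Suc k + (1 / 4) ^ k)" by (simp flip: ennreal_plus)
    also have "\<dots> \<le> ennreal (2 * (1 / 4) ^ k)" by (intro ennreal_leI) simp
    finally show ?thesis .
  qed
  \<comment> \<open>The weights \<open>2 ^ k\<close> grow slowly enough for the weighted sum to have
    a finite integral. By \<open>2 * z \<le> 1 + z\<^sup>2\<close> with
    \<open>z = 2 ^ k * cmod (d k \<xi>)\<close>, this sum and a geometric series together dominate
    the sum of the \<open>cmod (d k \<xi>)\<close>.\<close>
  have "(\<integral>\<^sup>+\<xi>. (\<Sum>k. ennreal (2 ^ k * (cmod (d k \<xi>))\<^sup>2)) \<partial>lborel) =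
      (\<Sum>k. \<integral>\<^sup>+\<xi>. ennreal (2 ^ k * (cmod (d k \<xi>))\<^sup>2) \<partial>lborel)"
    by (rule nn_integral_suminf) measurable
  also have "\<dots> = (\<Sum>k. ennreal (2 ^ k) * L2_sq (d k))"
    by (simp add: ennreal_mult nn_integral_cmult L2_sq_def)
  also have "\<dots> \<le> (\<Sum>k. ennreal (2 * (1 / 2) ^ k))"
  proof (intro suminf_le)
    fix k
    have "ennreal (2 ^ k) * L2_sq (d k) \<le> ennreal (2 ^ k) * ennreal (2 * (1 / 4) ^ k)"
      by (intro mult_left_mono dk) auto
    also have "\<dots> = ennreal (2 * (1 / 2) ^ k)"
      by (simp flip: ennreal_mult power_mult_distrib)
    finally show "ennreal (2 ^ k) * L2_sq (d k) \<le> ennreal (2 * (1 / 2) ^ k)" .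
  qed auto
  also have "\<dots> = ennreal (\<Sum>k. 2 * (1 / 2) ^ k)"
    by (intro suminf_ennreal2 summable_mult summable_geometric) auto
  also have "\<dots> < \<infinity>" by simp
  finally have "AE \<xi> in lborel. (\<Sum>k. ennreal (2 ^ k * (cmod (d k \<xi>))\<^sup>2)) \<noteq> \<infinity>"
    by (intro nn_integral_PInf_AE) auto
  then have conv: "AE \<xi> in lborel. convergent (\<lambda>k. \<Phi> k \<xi>)"
  proof eventually_elim
    case (elim \<xi>)
    have s: "summable (\<lambda>k. 2 ^ k * (cmod (d k \<xi>))\<^sup>2)"
      using elim by (intro summable_suminf_not_top) auto
    have "summable (\<lambda>k. (1 / 2) ^ k + 2 ^ k * (cmod (d k \<xi>))\<^sup>2)"
      by (intro summable_add s summable_geometric) simp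
    moreover have "norm (d k \<xi>) \<le> (1 / 2) ^ k + 2 ^ k * (cmod (d k \<xi>))\<^sup>2" for k
    proof -
      have "2 * (2 ^ k * cmod (d k \<xi>)) \<le> 1 + (2 ^ k * cmod (d k \<xi>))\<^sup>2"
        using sum_squares_bound[of "2 ^ k * cmod (d k \<xi>)" 1] by simp
      then have "2 ^ k * cmod (d k \<xi>) \<le> 1 + (2 ^ k * cmod (d k \<xi>))\<^sup>2"
        by (smt (verit) mult_nonneg_nonneg norm_ge_zero zero_le_power)
      also have "\<dots> = 2 ^ k * ((1 / 2) ^ k + 2 ^ k * (cmod (d k \<xi>))\<^sup>2)"
        by (simp add: power2_eq_square ring_distribs mult_ac flip: power_mult_distrib)
      finally show ?thesis by simp
    qed
    ultimately have "summable (\<lambda>k. d k \<xi>)" by (rule summable_comparison_test'[of _ 0])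
    then have "convergent (\<lambda>n. \<Sum>k<n. d k \<xi>)" by (simp add: summable_iff_convergent)
    moreover have "(\<Sum>k<n. d k \<xi>) = \<Phi> n \<xi> - \<Phi> 0 \<xi>" for n
      unfolding d_def by (rule sum_lessThan_telescope)
    ultimately have "convergent (\<lambda>n. \<Phi> n \<xi> - \<Phi> 0 \<xi>)" by simp
    then show ?case using convergent_add[OF _ convergent_const[of "\<Phi> 0 \<xi>"]] by fastforce
  qed
  \<comment> \<open>Where the sequence diverges, \<open>lim\<close> has an unspecified value; this
    happens on a null set only.\<close>
  define F where "F \<xi> = lim (\<lambda>k. \<Phi> k \<xi>)" for \<xi>
  have [measurable]: "F \<in> borel_measurable borel" unfolding F_def by measurable
  have F: "AE \<xi> in lborel. (\<lambda>k. \<Phi> k \<xi>) \<longlonglongrightarrow> F \<xi>"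
    using conv by eventually_elim (simp add: F_def convergent_LIMSEQ_iff)
  have r0: "(\<lambda>k. ennreal ((1 / 4) ^ k)) \<longlonglongrightarrow> 0"
    using tendsto_ennrealI[OF LIMSEQ_realpow_zero[of "1 / 4"]] by simp
  have FR: "L2_sq (\<lambda>\<xi>. F \<xi> - fourier_integral (cut R f) \<xi>) \<le> tail f R" for R
  proof -
    let ?G = "fourier_integral (cut R f)"
    have "L2_sq (\<lambda>\<xi>. F \<xi> - ?G \<xi>) = (\<integral>\<^sup>+\<xi>. liminf (\<lambda>k. ennreal ((cmod (\<Phi> k \<xi> - ?G \<xi>))\<^sup>2)) \<partial>lborel)"
      unfolding L2_sq_def
    proof (rule nn_integral_cong_AE, use F in eventually_elim)
      fix \<xi> assume "(\<lambda>k. \<Phi> k \<xi>) \<longlonglongrightarrow> F \<xi>"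
      then have "(\<lambda>k. ennreal ((cmod (\<Phi> k \<xi> - ?G \<xi>))\<^sup>2)) \<longlonglongrightarrow> ennreal ((cmod (F \<xi> - ?G \<xi>))\<^sup>2)"
        by (intro tendsto_ennrealI tendsto_intros)
      then show "ennreal ((cmod (F \<xi> - ?G \<xi>))\<^sup>2) = liminf (\<lambda>k. ennreal ((cmod (\<Phi> k \<xi> - ?G \<xi>))\<^sup>2))"
        by (intro lim_imp_Liminf[symmetric]) auto
    qed
    also have "\<dots> \<le> liminf (\<lambda>k. L2_sq (\<lambda>\<xi>. \<Phi> k \<xi> - ?G \<xi>))"
      unfolding L2_sq_def by (rule nn_integral_liminf) measurable
    also have "\<dots> \<le> liminf (\<lambda>k. ennreal ((1 / 4) ^ k) + tail f R)"
    proof (intro Liminf_mono always_eventually allI)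
      fix k
      have "L2_sq (\<lambda>\<xi>. \<Phi> k \<xi> - ?G \<xi>) \<le> tail f (r k) + tail f R"
        unfolding \<Phi>_def by (rule L2_sq_fourier_cut_diff_le[OF f])
      also have "\<dots> \<le> ennreal ((1 / 4) ^ k) + tail f R"
        by (intro add_mono less_imp_le[OF r] order_refl)
      finally show "L2_sq (\<lambda>\<xi>. \<Phi> k \<xi> - ?G \<xi>) \<le> ennreal ((1 / 4) ^ k) + tail f R" .
    qed
    also have "\<dots> = 0 + tail f R"
      by (intro lim_imp_Liminf tendsto_add r0 tendsto_const) simp
    finally show ?thesis by simp
  qed
  have "((\<lambda>R. L2_sq (\<lambda>\<xi>. F \<xi> - fourier_integral (cut R f) \<xi>)) \<longlongrightarrow> 0) at_top"
    by (rule tendsto_sandwich[OF _ _ tendsto_const tail_tendsto_0[OF f]]) (auto simp: FR)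
  moreover have "F \<in> L2"
  proof -
    have "L2_sq F \<le> 2 * L2_sq (\<lambda>\<xi>. F \<xi> - \<Phi> 0 \<xi>) + 2 * L2_sq (\<Phi> 0)"
      by (rule L2_sq_le_add) (auto simp: add.commute[of "cmod (_ - _)"] norm_triangle_sub)
    also have "\<dots> \<le> 2 * tail f (r 0) + 2 * L2_sq f"
      unfolding \<Phi>_def by (intro add_mono mult_left_mono FR L2_sq_fourier_cut_le f) auto
    also have "\<dots> < \<infinity>"
      using f less_trans[OF r[of 0] ennreal_less_top] by (simp add: L2_iff ennreal_mult_less_top)
    finally show ?thesis by (simp add: L2_iff)
  qed
  ultimately show ?thesis by (auto simp: is_fourier_transform_iff)
qed

section \<open>Uniqueness, additivity and boundedness of the transform\<close>

lemma is_fourier_transform_fourier: "f \<in> L2 \<Longrightarrow> is_fourier_transform f (fourier f)"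
  unfolding fourier_def by (rule someI_ex[OF is_fourier_transform_exists])

lemma fourier_in_L2: "f \<in> L2 \<Longrightarrow> fourier f \<in> L2"
  using is_fourier_transform_fourier is_fourier_transform_iff by blast

lemma is_fourier_transform_unique:
  assumes "is_fourier_transform f F" "is_fourier_transform f G"
    and [measurable]: "f \<in> borel_measurable borel"
  shows "AE \<xi> in lborel. F \<xi> = G \<xi>"
proof -
  let ?e = "\<lambda>F R. L2_sq (\<lambda>\<xi>. F \<xi> - fourier_integral (cut R f) \<xi>)"
  have FG: "F \<in> L2" "G \<in> L2" "(?e F \<longlongrightarrow> 0) at_top" "(?e G \<longlongrightarrow> 0) at_top"
    using assms(1,2) by (auto simp: is_fourier_transform_iff)
  note [measurable] = L2_measurable[OF FG(1)] L2_measurable[OF FG(2)]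
  have "((\<lambda>R. 2 * ?e F R + 2 * ?e G R) \<longlongrightarrow> 2 * 0 + 2 * 0) at_top"
    by (intro tendsto_add ennreal_tendsto_cmult FG) auto
  moreover have "L2_sq (\<lambda>\<xi>. F \<xi> - G \<xi>) \<le> 2 * ?e F R + 2 * ?e G R" for R
    by (rule L2_sq_le_add) (auto intro!: AE_I2 norm_triangle_ineq4[THEN order_trans[rotated]])
  ultimately have "L2_sq (\<lambda>\<xi>. F \<xi> - G \<xi>) \<le> 2 * 0 + 2 * 0"
    by (intro tendsto_lowerbound[where F = at_top] always_eventually) auto
  then have "AE \<xi> in lborel. ennreal ((cmod (F \<xi> - G \<xi>))\<^sup>2) = 0"
    unfolding L2_sq_def by (subst nn_integral_0_iff_AE[symmetric]) auto
  then show ?thesis by eventually_elim simp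
qed

lemma is_fourier_transform_diff:
  assumes f: "f \<in> L2" and g: "g \<in> L2" and F: "is_fourier_transform f F" and G: "is_fourier_transform g G"
  shows "is_fourier_transform (\<lambda>x. f x - g x) (\<lambda>\<xi>. F \<xi> - G \<xi>)"
proof -
  let ?e = "\<lambda>f F R. L2_sq (\<lambda>\<xi>. F \<xi> - fourier_integral (cut R f) \<xi>)"
  have FG: "F \<in> L2" "G \<in> L2" "(?e f F \<longlongrightarrow> 0) at_top" "(?e g G \<longlongrightarrow> 0) at_top"
    using F G by (auto simp: is_fourier_transform_iff)
  note [measurable] = L2_measurable[OF FG(1)] L2_measurable[OF FG(2)] L2_measurable[OF f] L2_measurable[OF g]
  have "((\<lambda>R. 2 * ?e f F R + 2 * ?e g G R) \<longlongrightarrow> 2 * 0 + 2 * 0) at_top"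
    by (intro tendsto_add ennreal_tendsto_cmult FG) auto
  then have lim: "((\<lambda>R. 2 * ?e f F R + 2 * ?e g G R) \<longlongrightarrow> 0) at_top" by simp
  have le: "?e (\<lambda>x. f x - g x) (\<lambda>\<xi>. F \<xi> - G \<xi>) R \<le> 2 * ?e f F R + 2 * ?e g G R" for R
  proof (rule L2_sq_le_add)
    have "cut R (\<lambda>x. f x - g x) = (\<lambda>x. cut R f x - cut R g x)"
      by (simp add: cut_def right_diff_distrib)
    then have "fourier_integral (cut R (\<lambda>x. f x - g x)) \<xi> =
        fourier_integral (cut R f) \<xi> - fourier_integral (cut R g) \<xi>" for \<xi>
      using integrable_cut[OF f] integrable_cut[OF g] by (simp add: fourier_integral_diff)
    moreover have "cmod (a - b - (c - d)) \<le> cmod (a - c) + cmod (b - d)" for a b c d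
      using norm_triangle_ineq4[of "a - c" "b - d"] by (simp add: algebra_simps)
    ultimately show "AE \<xi> in lborel. cmod (F \<xi> - G \<xi> - fourier_integral (cut R (\<lambda>x. f x - g x)) \<xi>)
       \<le> cmod (F \<xi> - fourier_integral (cut R f) \<xi>) + cmod (G \<xi> - fourier_integral (cut R g) \<xi>)"
      by simp
  qed measurable
  have "(?e (\<lambda>x. f x - g x) (\<lambda>\<xi>. F \<xi> - G \<xi>) \<longlongrightarrow> 0) at_top"
    by (rule tendsto_sandwich[OF _ _ tendsto_const lim]) (auto simp: le)
  then show ?thesis using L2_diff[OF FG(1,2)] by (simp add: is_fourier_transform_iff)
qed

lemma fourier_diff:
  assumes f: "f \<in> L2" and g: "g \<in> L2"
  shows "AE \<xi> in lborel. fourier (\<lambda>x. f x - g x) \<xi> = fourier f \<xi> - fourier g \<xi>"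
  using assms L2_diff[OF f g]
  by (intro is_fourier_transform_unique[of "\<lambda>x. f x - g x"] is_fourier_transform_diff is_fourier_transform_fourier)
     (auto simp: L2_iff)

text \<open>The bound for the truncations passes to the limit. The factor 2, where Plancherel's
  identity has 1, comes from \<open>L2_sq_le_add\<close> and ends up in the final constant.\<close>

lemma L2_sq_fourier_le:
  assumes f: "f \<in> L2"
  shows "L2_sq (fourier f) \<le> 2 * L2_sq f"
proof -
  let ?e = "\<lambda>R. L2_sq (\<lambda>\<xi>. fourier f \<xi> - fourier_integral (cut R f) \<xi>)"
  have F: "(?e \<longlongrightarrow> 0) at_top"
    using is_fourier_transform_fourier[OF f] by (simp add: is_fourier_transform_iff)
  note [measurable] = L2_measurable[OF f] L2_measurable[OF fourier_in_L2[OF f]]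
  have "((\<lambda>R. 2 * ?e R + 2 * L2_sq f) \<longlongrightarrow> 2 * 0 + 2 * L2_sq f) at_top"
    by (intro tendsto_add ennreal_tendsto_cmult F tendsto_const) auto
  moreover have "L2_sq (fourier f) \<le> 2 * ?e R + 2 * L2_sq f" for R
  proof -
    have "L2_sq (fourier f) \<le> 2 * ?e R + 2 * L2_sq (fourier_integral (cut R f))"
      by (rule L2_sq_le_add) (auto simp: add.commute[of "cmod (_ - _)"] norm_triangle_sub)
    also have "\<dots> \<le> 2 * ?e R + 2 * L2_sq f"
      by (intro add_mono order_refl mult_left_mono L2_sq_fourier_cut_le f) auto
    finally show ?thesis .
  qed
  ultimately have "L2_sq (fourier f) \<le> 2 * 0 + 2 * L2_sq f"
    by (intro tendsto_lowerbound[where F = at_top] always_eventually) auto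
  then show ?thesis by simp
qed

text \<open>\<open>is_fourier_transform\<close> sees a function only through its integrals over
  balls, so both functions yield the same predicate and the choice operator picks the same
  transform. Hence equality holds everywhere.\<close>

lemma fourier_cong_AE:
  assumes f[measurable]: "f \<in> borel_measurable borel" and g[measurable]: "g \<in> borel_measurable borel"
    and eq: "AE x in lborel. f x = g x"
  shows "fourier f = fourier g"
proof -
  have "fourier_integral (cut R f) = fourier_integral (cut R g)" for R
  proof
    fix \<xi>
    have "(\<integral>x. cut R f x * exp (- (\<i> * complex_of_real (x \<bullet> \<xi>))) \<partial>lborel) =
        (\<integral>x. cut R g x * exp (- (\<i> * complex_of_real (x \<bullet> \<xi>))) \<partial>lborel)"
    proof (rule integral_cong_AE)
      show "AE x in lborel. cut R f x * exp (- (\<i> * complex_of_real (x \<bullet> \<xi>))) =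
          cut R g x * exp (- (\<i> * complex_of_real (x \<bullet> \<xi>)))"
        using eq by eventually_elim (simp add: cut_def)
    qed measurable
    then show "fourier_integral (cut R f) \<xi> = fourier_integral (cut R g) \<xi>"
      by (simp add: fourier_integral_def)
  qed
  then have "is_fourier_transform f = is_fourier_transform g"
    by (auto simp: is_fourier_transform_iff)
  then show ?thesis by (simp add: fourier_def)
qed

section \<open>Regularization error\<close>

text \<open>The left-hand side is at most \<open>min 1 y\<close>, which is at most
  \<open>y powr \<theta>\<close> for these exponents.\<close>

lemma one_minus_exp_le_powr:
  fixes y \<theta> :: real
  assumes "0 < y" "0 \<le> \<theta>" "\<theta> \<le> 1"
  shows "1 - exp (- y) \<le> y powr \<theta>"
proof (cases "y \<le> 1")
  case True
  have "1 - exp (- y) \<le> y" using exp_ge_add_one_self[of "- y"] by linarith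
  also have "y = y powr 1" using assms by simp
  also have "\<dots> \<le> y powr \<theta>" using assms True by (intro powr_mono') auto
  finally show ?thesis .
next
  case False
  have "1 - exp (- y) \<le> 1" by simp
  also have "\<dots> \<le> y powr \<theta>" using assms False by (intro ge_one_powr_ge_zero) auto
  finally show ?thesis .
qed

lemma powr_le_one_plus_square_powr:
  fixes n r :: real
  assumes "0 \<le> n" "0 \<le> r"
  shows "n powr r \<le> (1 + n\<^sup>2) powr (r / 2)"
proof -
  have "n powr r = (n\<^sup>2) powr (r / 2)"
    using assms by (cases "n = 0") (auto simp: powr_powr simp flip: powr_numeral)
  also have "\<dots> \<le> (1 + n\<^sup>2) powr (r / 2)"
    using assms by (intro powr_mono2) auto
  finally show ?thesis .
qed

text \<open>The restriction \<open>p - l \<le> s\<close> enters here, as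
  \<open>\<theta> \<le> 1\<close>. The surplus smoothness \<open>p - l\<close> is traded for a power
  of \<open>\<alpha>\<close>, and \<open>\<tau> powr \<theta> \<le> 1 + \<tau>\<close> keeps the
  constant free of \<open>l\<close>.\<close>

lemma filter_bias_bound:
  fixes \<tau> s p l \<alpha> n :: real
  assumes "0 < \<tau>" "0 < s" "l \<le> p" "p - l \<le> s" "0 < \<alpha>" "0 \<le> n"
  shows "(1 + n\<^sup>2) powr (l / 2) * (1 - exp (- \<tau> * (\<alpha> * n) powr s))
    \<le> (1 + \<tau>) * \<alpha> powr (p - l) * (1 + n\<^sup>2) powr (p / 2)"
proof (cases "n = 0")
  case True
  then show ?thesis using assms by simp
next
  case False
  define \<theta> where "\<theta> = (p - l) / s"
  have \<theta>: "0 \<le> \<theta>" "\<theta> \<le> 1" "s * \<theta> = p - l" using assms by (auto simp: \<theta>_def)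
  have n: "0 < n" using False assms by simp
  have pos: "0 < 1 + n\<^sup>2" by (simp add: add_pos_nonneg)
  have "0 < \<tau> * (\<alpha> * n) powr s" using assms n by simp
  then have "1 - exp (- (\<tau> * (\<alpha> * n) powr s)) \<le> (\<tau> * (\<alpha> * n) powr s) powr \<theta>"
    using \<theta>(1,2) by (rule one_minus_exp_le_powr)
  also have "\<dots> = \<tau> powr \<theta> * (\<alpha> powr (p - l) * n powr (p - l))"
    using assms n by (simp add: powr_mult powr_powr \<theta>)
  also have "\<dots> \<le> (1 + \<tau>) * (\<alpha> powr (p - l) * (1 + n\<^sup>2) powr ((p - l) / 2))"
  proof (intro mult_mono order_refl)
    have "\<tau> powr \<theta> \<le> (1 + \<tau>) powr \<theta>" using assms \<theta> by (intro powr_mono2) auto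
    also have "\<dots> \<le> (1 + \<tau>) powr 1" using assms \<theta> by (intro powr_mono) auto
    finally show "\<tau> powr \<theta> \<le> 1 + \<tau>" using assms by simp
    show "n powr (p - l) \<le> (1 + n\<^sup>2) powr ((p - l) / 2)"
      using assms by (intro powr_le_one_plus_square_powr) auto
  qed (use assms in auto)
  finally have "(1 + n\<^sup>2) powr (l / 2) * (1 - exp (- (\<tau> * (\<alpha> * n) powr s)))
     \<le> (1 + n\<^sup>2) powr (l / 2) * ((1 + \<tau>) * (\<alpha> powr (p - l) * (1 + n\<^sup>2) powr ((p - l) / 2)))"
    by (intro mult_left_mono) auto
  also have "\<dots> = (1 + \<tau>) * \<alpha> powr (p - l) * ((1 + n\<^sup>2) powr (l / 2) * (1 + n\<^sup>2) powr ((p - l) / 2))"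
    by (simp only: mult_ac)
  also have "(1 + n\<^sup>2) powr (l / 2) * (1 + n\<^sup>2) powr ((p - l) / 2) = (1 + n\<^sup>2) powr (p / 2)"
    by (simp flip: powr_add add_divide_distrib)
  finally show ?thesis by simp
qed

text \<open>The last factor \<open>1 + n\<^sup>2\<close> on the left is the cost of dividing by the
  Mittag-Leffler function. With \<open>y = \<alpha> * n\<close> the whole weight is \<open>\<alpha>
  powr (- (l + 2)) * (\<alpha>\<^sup>2 + y\<^sup>2) powr ((l + 2) / 2)\<close>; the filter beats the
  power of \<open>y\<close>, and \<open>a\<close> controls \<open>\<alpha>\<^sup>2\<close>.\<close>

lemma filter_noise_bound:
  fixes \<tau> s p a :: real
  assumes "0 < \<tau>" "0 < s" "0 < p"
  obtains B where "0 < B"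
    and "\<And>\<alpha> n l. 0 < \<alpha> \<Longrightarrow> \<alpha> \<le> a \<Longrightarrow> 0 \<le> n \<Longrightarrow> 0 \<le> l \<Longrightarrow> l \<le> p \<Longrightarrow>
      (1 + n\<^sup>2) powr (l / 2) * exp (- \<tau> * (\<alpha> * n) powr s) * (1 + n\<^sup>2) \<le> B * \<alpha> powr (- (l + 2))"
proof
  \<comment> \<open>The exponents belong to the worst case \<open>l = p\<close>, so that one
    constant serves all \<open>l\<close>; \<open>b \<ge> 1\<close> allows the exponent to be raised
    to \<open>m\<close>. \<open>D\<close> bounds \<open>y powr (p + 2)\<close> times the filter, by
    \<open>Gamma_lower_bound\<close> with exponent \<open>q\<close>.\<close>
  define q where "q = (p + 2) / s"
  define m where "m = (p + 2) / 2"
  define b where "b = 1 + a\<^sup>2"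
  define D where "D = Gamma (q + 1) / \<tau> powr q"
  have q: "0 < q" "s * q = p + 2" using assms by (auto simp: q_def)
  have m: "0 < m" using assms by (simp add: m_def)
  have b: "1 \<le> b" by (simp add: b_def)
  have D: "0 < D" unfolding D_def using q assms by (intro divide_pos_pos Gamma_real_pos) auto
  show "0 < 2 powr m * (b powr m + D)" using b D by (intro mult_pos_pos add_nonneg_pos) auto
  fix \<alpha> n l :: real
  assume \<alpha>: "0 < \<alpha>" "\<alpha> \<le> a" and n: "0 \<le> n" and l: "0 \<le> l" "l \<le> p"
  define y where "y = \<alpha> * n"
  define e where "e = exp (- \<tau> * y powr s)"
  have y: "0 \<le> y" using \<alpha> n by (simp add: y_def)
  have e: "0 < e" "e \<le> 1" using assms by (auto simp: e_def)
  have ye: "y powr (p + 2) * e \<le> D"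
  proof -
    have "(\<tau> * y powr s) powr q * e \<le> Gamma (q + 1)"
      using Gamma_lower_bound[of "\<tau> * y powr s" q] assms q by (simp add: e_def)
    moreover have "(\<tau> * y powr s) powr q = \<tau> powr q * y powr (p + 2)"
      using assms y by (simp add: powr_mult powr_powr q)
    ultimately show ?thesis using assms by (simp add: D_def pos_le_divide_eq mult_ac)
  qed
  have "(b + y\<^sup>2) powr m * e \<le> 2 powr m * (b powr m + D)"
  proof -
    have "(b + y\<^sup>2) powr m \<le> (2 * max b (y\<^sup>2)) powr m"
      using b m by (intro powr_mono2) auto
    also have "\<dots> = 2 powr m * (max b (y\<^sup>2)) powr m" using b by (simp add: powr_mult)
    also have "\<dots> \<le> 2 powr m * (b powr m + y powr (p + 2))"
    proof (intro mult_left_mono)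
      have "(y\<^sup>2) powr m = y powr (2 * m)"
        using y by (cases "y = 0") (auto simp: powr_powr simp flip: powr_numeral)
      also have "2 * m = p + 2" by (simp add: m_def)
      finally have "(y\<^sup>2) powr m = y powr (p + 2)" .
      then show "(max b (y\<^sup>2)) powr m \<le> b powr m + y powr (p + 2)" by (simp add: max_def)
    qed auto
    finally have "(b + y\<^sup>2) powr m * e \<le> 2 powr m * (b powr m + y powr (p + 2)) * e"
      using e by (intro mult_right_mono) auto
    also have "\<dots> = 2 powr m * (b powr m * e + y powr (p + 2) * e)" by (simp add: algebra_simps)
    also have "\<dots> \<le> 2 powr m * (b powr m + D)"
      using ye e by (intro mult_left_mono add_mono) (auto simp: mult_left_le)
    finally show ?thesis .
  qed
  moreover have "(\<alpha>\<^sup>2 + y\<^sup>2) powr ((l + 2) / 2) \<le> (b + y\<^sup>2) powr m"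
  proof -
    have "\<alpha>\<^sup>2 \<le> a\<^sup>2" using \<alpha> by (intro power_mono) auto
    then have "(\<alpha>\<^sup>2 + y\<^sup>2) powr ((l + 2) / 2) \<le> (b + y\<^sup>2) powr ((l + 2) / 2)"
      using l by (intro powr_mono2) (auto simp: b_def)
    also have "\<dots> \<le> (b + y\<^sup>2) powr m"
      using l b by (intro powr_mono) (auto simp: m_def add_increasing2)
    finally show ?thesis .
  qed
  ultimately have le: "(\<alpha>\<^sup>2 + y\<^sup>2) powr ((l + 2) / 2) * e \<le> 2 powr m * (b powr m + D)"
    using e by (meson less_imp_le mult_right_mono order_trans)
  have pos: "0 < 1 + n\<^sup>2" by (simp add: add_pos_nonneg)
  have "(1 + n\<^sup>2) powr (l / 2) * (1 + n\<^sup>2) = (1 + n\<^sup>2) powr ((l + 2) / 2)"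
    using pos powr_add[of "1 + n\<^sup>2" "l / 2" 1] by (simp add: add_divide_distrib)
  also have "\<dots> = \<alpha> powr (- (l + 2)) * (\<alpha>\<^sup>2 + y\<^sup>2) powr ((l + 2) / 2)"
  proof -
    have "\<alpha>\<^sup>2 + y\<^sup>2 = \<alpha>\<^sup>2 * (1 + n\<^sup>2)" by (simp add: y_def power_mult_distrib algebra_simps)
    moreover have "(\<alpha>\<^sup>2) powr r = \<alpha> powr (2 * r)" for r
      using \<alpha> by (simp add: powr_powr flip: powr_numeral)
    from this[of "(l + 2) / 2"] have "(\<alpha>\<^sup>2) powr ((l + 2) / 2) = \<alpha> powr (l + 2)"
      by (simp only: nonzero_mult_div_cancel_left times_divide_eq_right)
    moreover have "\<alpha> powr (- (l + 2)) * \<alpha> powr (l + 2) = 1"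
      using \<alpha> by (simp flip: powr_add)
    ultimately show ?thesis using pos by (simp add: powr_mult flip: mult.assoc)
  qed
  finally have eq: "(1 + n\<^sup>2) powr (l / 2) * (1 + n\<^sup>2) = \<alpha> powr (- (l + 2)) * (\<alpha>\<^sup>2 + y\<^sup>2) powr ((l + 2) / 2)" .
  have "(1 + n\<^sup>2) powr (l / 2) * exp (- \<tau> * (\<alpha> * n) powr s) * (1 + n\<^sup>2) =
      \<alpha> powr (- (l + 2)) * ((\<alpha>\<^sup>2 + y\<^sup>2) powr ((l + 2) / 2) * e)"
    using eq by (simp add: e_def y_def mult_ac)
  also have "\<dots> \<le> \<alpha> powr (- (l + 2)) * (2 powr m * (b powr m + D))"
    by (intro mult_left_mono le) simp
  finally show "(1 + n\<^sup>2) powr (l / 2) * exp (- \<tau> * (\<alpha> * n) powr s) * (1 + n\<^sup>2)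
      \<le> 2 powr m * (b powr m + D) * \<alpha> powr (- (l + 2))"
    by (simp add: mult_ac)
qed

text \<open>With \<open>a\<close> and \<open>d\<close> for the transforms of \<open>u 0\<close> and
  \<open>g\<delta>\<close>, \<open>m\<close> for the Mittag-Leffler value and \<open>e\<close> for
  the filter, \<open>a - e / m * d = (1 - e) * a + e / m * (a * m - d)\<close>, where
  \<open>a * m\<close> is the transform of \<open>g\<close>.\<close>

lemma fourier_regularization_error:
  fixes u :: "real \<Rightarrow> 'a::euclidean_space \<Rightarrow> complex"
  assumes \<gamma>: "0 < \<gamma>" and T: "0 < T"
    and M: "\<And>\<xi>::'a. mittag_leffler \<gamma> (- (norm \<xi>)\<^sup>2 * T powr \<gamma>) \<noteq> 0"
    and u: "final_value_solution \<gamma> T g u" and g\<delta>: "g\<delta> \<in> L2"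
    and v: "regularized_solution \<gamma> T \<tau> s \<alpha> g\<delta> v"
  shows "AE \<xi> in lborel. fourier (\<lambda>x. u 0 x - v 0 x) \<xi> =
    complex_of_real (1 - exp (- \<tau> * (\<alpha> * norm \<xi>) powr s)) * fourier (u 0) \<xi> +
    complex_of_real (exp (- \<tau> * (\<alpha> * norm \<xi>) powr s) / mittag_leffler \<gamma> (- (norm \<xi>)\<^sup>2 * T powr \<gamma>)) *
      fourier (\<lambda>x. g x - g\<delta> x) \<xi>"
proof -
  have g: "g \<in> L2" and sol: "frac_diffusion_solution \<gamma> T u" and uTg: "AE x in lborel. u T x = g x"
    using u by (auto simp: final_value_solution_def)
  have 0: "0 \<in> {0..T}" and 1: "T \<in> {0..T}" using T by auto
  have uL: "u 0 \<in> L2" "u T \<in> L2" using sol 0 1 unfolding frac_diffusion_solution_def by blast+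
  have vL: "v 0 \<in> L2" using v 0 unfolding regularized_solution_def by blast
  have uT: "AE \<xi> in lborel. fourier (u T) \<xi> =
     fourier (u 0) \<xi> * complex_of_real (mittag_leffler \<gamma> (- (norm \<xi>)\<^sup>2 * T powr \<gamma>))"
    using sol 1 unfolding frac_diffusion_solution_def by blast
  have "fourier (u T) = fourier g"
    using uTg L2_measurable[OF uL(2)] L2_measurable[OF g] by (intro fourier_cong_AE)
  note uT = uT[unfolded this]
  \<comment> \<open>At time 0 the numerator is the Mittag-Leffler function at 0, since
    \<open>0 powr \<gamma> = 0\<close>.\<close>
  have v0: "AE \<xi> in lborel. fourier (v 0) \<xi> =
      complex_of_real (1 / mittag_leffler \<gamma> (- (norm \<xi>)\<^sup>2 * T powr \<gamma>) *
        exp (- \<tau> * (\<alpha> * norm \<xi>) powr s)) * fourier g\<delta> \<xi>"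
    using v 0 \<gamma> unfolding regularized_solution_def by fastforce
  from uT v0 fourier_diff[OF uL(1) vL] fourier_diff[OF g g\<delta>] show ?thesis
  proof eventually_elim
    case (elim \<xi>)
    define m where "m = complex_of_real (mittag_leffler \<gamma> (- (norm \<xi>)\<^sup>2 * T powr \<gamma>))"
    define e where "e = complex_of_real (exp (- \<tau> * (\<alpha> * norm \<xi>) powr s))"
    have "m \<noteq> 0" using M[of \<xi>] by (simp add: m_def)
    then have eq: "a - 1 / m * e * d = (1 - e) * a + e / m * (a * m - d)" for a d
      by (simp add: field_simps)
    show ?case
      unfolding elim of_real_mult of_real_divide of_real_diff of_real_1 m_def[symmetric] e_def[symmetric] by (rule eq)
  qed
qed

text \<open>A bound \<open>K\<close> on \<open>\<delta> / E\<close> is fixed before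
  \<open>C\<close>, because noise at frequencies below \<open>1 / \<alpha>\<close> passes the filter
  with norm of order \<open>\<delta>\<close>, while the right-hand side is
  \<open>C * \<delta> * (E / \<delta>) powr ((2 + l) / (p + 2))\<close>, which is of smaller order
  as \<open>\<delta> / E\<close> grows. Membership in \<open>sobolev l\<close> is asserted because
  \<open>L2_norm\<close> is 0, by convention for integrals, on measurable functions outside
  \<open>L2\<close>.\<close>

theorem theorem1:
  fixes \<gamma> T \<tau> s p K :: real
  assumes "0 < \<gamma>" and "\<gamma> < 1" and "0 < T" and "0 < \<tau>" and "0 < s" and "0 < p" and "0 < K"
  shows "\<exists>C>0. \<forall>\<delta>>0. \<forall>E>0. \<delta> \<le> K * E \<longrightarrow>
    (\<forall>(u :: real \<Rightarrow> real ^ 'n \<Rightarrow> complex) g g\<delta> v.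
       final_value_solution \<gamma> T g u \<longrightarrow>
       u 0 \<in> sobolev p \<longrightarrow> sobolev_norm p (u 0) \<le> E \<longrightarrow>
       g\<delta> \<in> L2 \<longrightarrow> L2_norm (\<lambda>x. g x - g\<delta> x) \<le> \<delta> \<longrightarrow>
       regularized_solution \<gamma> T \<tau> s ((\<delta> / E) powr (1 / (p + 2))) g\<delta> v \<longrightarrow>
       (\<forall>l\<in>{0..p}. p - l \<le> s \<longrightarrow>
          (\<lambda>x. u 0 x - v 0 x) \<in> sobolev l \<and>
          sobolev_norm l (\<lambda>x. u 0 x - v 0 x)
            \<le> C * E powr ((2 + l) / (p + 2)) * \<delta> powr ((p - l) / (p + 2))))"
proof -
  let ?M = "\<lambda>\<xi>::real^'n. mittag_leffler \<gamma> (- (norm \<xi>)\<^sup>2 * T powr \<gamma>)"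
  obtain A where A: "0 < A" and ml:
    "\<And>y. 0 \<le> y \<Longrightarrow> 0 < mittag_leffler \<gamma> (- (y * T powr \<gamma>)) \<and> 1 / mittag_leffler \<gamma> (- (y * T powr \<gamma>)) \<le> A * (1 + y)"
    using mittag_leffler_inverse_bound[OF assms(1,2), of "T powr \<gamma>"] by auto
  have M: "0 < ?M \<xi>" "1 / ?M \<xi> \<le> A * (1 + (norm \<xi>)\<^sup>2)" for \<xi>
    using ml[of "(norm \<xi>)\<^sup>2"] by auto
  obtain B where B: "0 < B" and noise:
    "\<And>\<alpha> n l. 0 < \<alpha> \<Longrightarrow> \<alpha> \<le> K powr (1 / (p + 2)) \<Longrightarrow> 0 \<le> n \<Longrightarrow> 0 \<le> l \<Longrightarrow> l \<le> p \<Longrightarrow>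
      (1 + n\<^sup>2) powr (l / 2) * exp (- \<tau> * (\<alpha> * n) powr s) * (1 + n\<^sup>2) \<le> B * \<alpha> powr (- (l + 2))"
    using filter_noise_bound[OF assms(4,5,6)] by blast
  \<comment> \<open>With \<open>x = 1 + \<tau>\<close> and \<open>y = A * B\<close> the squared
    error will be at most \<open>(2 * x\<^sup>2 + 4 * y\<^sup>2) * Q\<^sup>2\<close>: one factor 2
    comes from \<open>L2_sq_le_add\<close>, a further one at \<open>y\<close> from
    \<open>L2_sq_fourier_le\<close>. The square of \<open>2 * x + 2 * y\<close> dominates
    this.\<close>
  define C where "C = 2 * (1 + \<tau>) + 2 * (A * B)"
  have C: "0 < C" using A B assms by (simp add: C_def add_pos_pos)
  show ?thesis
  proof (intro exI[of _ C] conjI[OF C] allI impI ballI, goal_cases)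
    case (1 \<delta> E u g g\<delta> v l)
    then have \<delta>: "0 < \<delta>" and E: "0 < E" and \<delta>E: "\<delta> \<le> K * E" and u: "final_value_solution \<gamma> T g u"
      and u0: "u 0 \<in> sobolev p" and u0E: "sobolev_norm p (u 0) \<le> E" and g\<delta>: "g\<delta> \<in> L2"
      and gg: "L2_norm (\<lambda>x. g x - g\<delta> x) \<le> \<delta>"
      and v: "regularized_solution \<gamma> T \<tau> s ((\<delta> / E) powr (1 / (p + 2))) g\<delta> v"
      and l: "0 \<le> l" "l \<le> p" "p - l \<le> s"
      by auto
    define \<alpha> where "\<alpha> = (\<delta> / E) powr (1 / (p + 2))"
    \<comment> \<open>The choice of \<open>\<alpha>\<close> makes
      \<open>\<alpha> powr (p - l) * E\<close> and
      \<open>\<alpha> powr (- (l + 2)) * \<delta>\<close> both equal to this rate.\<close>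
    define Q where "Q = E powr ((2 + l) / (p + 2)) * \<delta> powr ((p - l) / (p + 2))"
    \<comment> \<open>Here \<open>\<delta> \<le> K * E\<close> enters: it keeps
      \<open>\<alpha>\<close> in the range of the noise estimate.\<close>
    have \<alpha>: "0 < \<alpha>" "\<alpha> \<le> K powr (1 / (p + 2))"
      using \<delta> E \<delta>E assms by (auto simp: \<alpha>_def field_simps intro!: powr_mono2)
    have Q: "0 < Q" using \<delta> E by (simp add: Q_def)
    have \<alpha>r: "\<alpha> powr r = \<delta> powr (r / (p + 2)) * E powr (- (r / (p + 2)))" for r
      using \<delta> E by (simp add: \<alpha>_def powr_powr powr_divide powr_minus_divide)
    have Q1: "\<alpha> powr (p - l) * E = Q"
    proof -
      have "\<alpha> powr (p - l) * E = \<delta> powr ((p - l) / (p + 2)) * (E powr (- ((p - l) / (p + 2))) * E powr 1)"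
        using E by (simp add: \<alpha>r)
      also have "E powr (- ((p - l) / (p + 2))) * E powr 1 = E powr ((2 + l) / (p + 2))"
        using assms by (subst powr_add[symmetric]) (simp add: field_simps)
      finally show ?thesis by (simp add: Q_def mult_ac)
    qed
    have Q2: "\<alpha> powr (- (l + 2)) * \<delta> = Q"
    proof -
      have "\<alpha> powr (- (l + 2)) = \<delta> powr (- ((l + 2) / (p + 2))) * E powr ((2 + l) / (p + 2))"
        unfolding \<alpha>r minus_divide_left[symmetric] minus_minus add.commute[of 2 l] by (rule refl)
      moreover have "\<delta> powr (- ((l + 2) / (p + 2))) * \<delta> powr 1 = \<delta> powr ((p - l) / (p + 2))"
        using assms by (subst powr_add[symmetric]) (simp add: field_simps)
      ultimately show ?thesis using \<delta> by (simp add: Q_def mult_ac)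
    qed
    have 0: "0 \<in> {0..T}" using assms by auto
    have gL: "g \<in> L2" using u by (auto simp: final_value_solution_def)
    have uL: "u 0 \<in> L2"
      using u 0 unfolding final_value_solution_def frac_diffusion_solution_def by blast
    have vL: "v 0 \<in> L2" using v 0 unfolding regularized_solution_def by blast
    note uv = L2_diff[OF uL vL] and h = L2_diff[OF gL g\<delta>]
    note [measurable] = L2_measurable[OF fourier_in_L2[OF uv]] L2_measurable[OF fourier_in_L2[OF h]]
      L2_measurable[OF fourier_in_L2[OF uL]]
    let ?W = "sobolev_weighted l (\<lambda>x. u 0 x - v 0 x)"
    let ?U = "sobolev_weighted p (u 0)" and ?H = "fourier (\<lambda>x. g x - g\<delta> x)"
    define a where "a = (1 + \<tau>) * \<alpha> powr (p - l)"
    define b where "b = A * B * \<alpha> powr (- (l + 2))"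
    have ab: "0 < a" "0 < b" using assms A B \<alpha> by (auto simp: a_def b_def)
    have [measurable]: "?W \<in> borel_measurable borel" "?U \<in> borel_measurable borel"
      unfolding sobolev_weighted_def[abs_def] by measurable
    have U: "L2_sq ?U \<le> ennreal (E\<^sup>2)"
      using u0 u0E E by (subst L2_sq_le_iff) (auto simp: sobolev_def sobolev_norm_def)
    have H: "L2_sq ?H \<le> ennreal (2 * \<delta>\<^sup>2)"
    proof -
      have "L2_sq ?H \<le> 2 * L2_sq (\<lambda>x. g x - g\<delta> x)" by (rule L2_sq_fourier_le[OF h])
      also have "\<dots> \<le> 2 * ennreal (\<delta>\<^sup>2)"
        using gg \<delta> by (intro mult_left_mono) (auto simp: L2_sq_le_iff[OF h])
      finally show ?thesis by (simp add: ennreal_mult)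
    qed
    have "AE \<xi> in lborel. cmod (?W \<xi>) \<le> cmod (complex_of_real a * ?U \<xi>) + cmod (complex_of_real b * ?H \<xi>)"
    proof -
      have "AE \<xi> in lborel. fourier (\<lambda>x. u 0 x - v 0 x) \<xi> =
        complex_of_real (1 - exp (- \<tau> * (\<alpha> * norm \<xi>) powr s)) * fourier (u 0) \<xi> +
        complex_of_real (exp (- \<tau> * (\<alpha> * norm \<xi>) powr s) / ?M \<xi>) * ?H \<xi>"
        using M(1) by (intro fourier_regularization_error[OF assms(1,3) _ u g\<delta> v[folded \<alpha>_def]]) (auto simp: less_le)
      then show ?thesis
      proof eventually_elim
        case (elim \<xi>)
        define n where "n = norm \<xi>"
        define w where "w = (1 + n\<^sup>2) powr (l / 2)"
        define e where "e = exp (- \<tau> * (\<alpha> * n) powr s)"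
        have e: "0 < e" "e \<le> 1" using assms by (auto simp: e_def)
        have bias: "w * (1 - e) \<le> a * (1 + n\<^sup>2) powr (p / 2)"
          unfolding w_def e_def a_def n_def using assms l \<alpha> by (intro filter_bias_bound) auto
        have "w * (e / ?M \<xi>) = w * e * (1 / ?M \<xi>)" by simp
        also have "\<dots> \<le> w * e * (A * (1 + n\<^sup>2))"
          using M(2)[of \<xi>] e by (intro mult_left_mono) (auto simp: w_def n_def)
        also have "\<dots> = A * (w * e * (1 + n\<^sup>2))" by simp
        also have "\<dots> \<le> A * (B * \<alpha> powr (- (l + 2)))"
          unfolding w_def e_def n_def using \<alpha> l A by (intro mult_left_mono noise) auto
        finally have noise': "w * (e / ?M \<xi>) \<le> b" by (simp add: b_def)
        have "cmod (?W \<xi>) = w * cmod (complex_of_real (1 - e) * fourier (u 0) \<xi> + complex_of_real (e / ?M \<xi>) * ?H \<xi>)"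
          unfolding sobolev_weighted_def elim by (simp add: norm_mult w_def e_def n_def)
        also have "\<dots> \<le> w * (cmod (complex_of_real (1 - e) * fourier (u 0) \<xi>) + cmod (complex_of_real (e / ?M \<xi>) * ?H \<xi>))"
          by (intro mult_left_mono norm_triangle_ineq) (simp add: w_def)
        also have "\<dots> = w * (1 - e) * cmod (fourier (u 0) \<xi>) + w * (e / ?M \<xi>) * cmod (?H \<xi>)"
          using e M(1)[of \<xi>] unfolding norm_mult norm_of_real by (simp add: algebra_simps)
        also have "\<dots> \<le> a * (1 + n\<^sup>2) powr (p / 2) * cmod (fourier (u 0) \<xi>) + b * cmod (?H \<xi>)"
          by (intro add_mono mult_right_mono bias noise') auto
        also have "\<dots> = cmod (complex_of_real a * ?U \<xi>) + cmod (complex_of_real b * ?H \<xi>)"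
          using ab by (simp add: sobolev_weighted_def norm_mult n_def)
        finally show ?case .
      qed
    qed
    then have "L2_sq ?W \<le> 2 * L2_sq (\<lambda>\<xi>. complex_of_real a * ?U \<xi>) + 2 * L2_sq (\<lambda>\<xi>. complex_of_real b * ?H \<xi>)"
      by (intro L2_sq_le_add) measurable
    also have "\<dots> = 2 * (ennreal (a\<^sup>2) * L2_sq ?U) + 2 * (ennreal (b\<^sup>2) * L2_sq ?H)"
      by (simp add: L2_sq_scale)
    also have "\<dots> \<le> 2 * (ennreal (a\<^sup>2) * ennreal (E\<^sup>2)) + 2 * (ennreal (b\<^sup>2) * ennreal (2 * \<delta>\<^sup>2))"
      by (intro add_mono mult_left_mono U H) auto
    also have "\<dots> = ennreal (2 * (a * E)\<^sup>2 + 4 * (b * \<delta>)\<^sup>2)"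
      by (simp add: ennreal_plus ennreal_mult power_mult_distrib mult_ac)
    also have "\<dots> \<le> ennreal ((C * Q)\<^sup>2)"
    proof (rule ennreal_leI)
      have eqs: "a * E = (1 + \<tau>) * Q" "b * \<delta> = A * B * Q"
        unfolding a_def b_def mult.assoc Q1 Q2 by (rule refl)+
      have "2 * (x * Q)\<^sup>2 + 4 * (y * Q)\<^sup>2 = (2 * x\<^sup>2 + 4 * y\<^sup>2) * Q\<^sup>2" for x y
        by (simp add: power_mult_distrib algebra_simps)
      then have "2 * (a * E)\<^sup>2 + 4 * (b * \<delta>)\<^sup>2 = (2 * (1 + \<tau>)\<^sup>2 + 4 * (A * B)\<^sup>2) * Q\<^sup>2"
        unfolding eqs .
      also have "\<dots> \<le> C\<^sup>2 * Q\<^sup>2"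
      proof (rule mult_right_mono)
        have ineq: "2 * x\<^sup>2 + 4 * y\<^sup>2 \<le> (2 * x + 2 * y)\<^sup>2" if "0 \<le> x" "0 \<le> y" for x y :: real
          using that by (simp add: power2_eq_square algebra_simps)
        show "2 * (1 + \<tau>)\<^sup>2 + 4 * (A * B)\<^sup>2 \<le> C\<^sup>2"
          unfolding C_def by (rule ineq) (use A B assms in auto)
      qed simp
      finally show "2 * (a * E)\<^sup>2 + 4 * (b * \<delta>)\<^sup>2 \<le> (C * Q)\<^sup>2" by (simp add: power_mult_distrib)
    qed
    finally have W: "L2_sq ?W \<le> ennreal ((C * Q)\<^sup>2)" .
    \<comment> \<open>Membership comes first, since \<open>L2_sq_le_iff\<close> translates the bound
      into one for \<open>L2_norm\<close> only on \<open>L2\<close>.\<close>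
    then have WL: "?W \<in> L2"
      unfolding L2_iff by (auto intro: le_less_trans)
    then have "L2_norm ?W \<le> C * Q"
      using W C Q by (subst L2_sq_le_iff[symmetric]) auto
    with WL uv show ?case by (simp add: sobolev_def sobolev_norm_def Q_def mult.assoc)
  qed
qed

end
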